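(* Let $\mathbf P$ be an irreducible $s\times s$ stochastic matrix with stationary row vector $\boldsymbol\pi=\mathbf 1_s^\top(\mathbf I_s-\mathbf P+\mathbf A)^{-1}$, where $\mathbf A=\mathbf 1_s\mathbf 1_s^\top$. With $\widehat{\mathbf P}(n)$ the maximum likelihood estimator of $\mathbf P$, the plug-in estimator $\widehat{\boldsymbol\pi}(n)=\mathbf 1_s^\top(\mathbf I_s-\widehat{\mathbf P}(n)+\mathbf A)^{-1}$ is strongly consistent for $\boldsymbol\pi$ and $$\sqrt n\{\widehat{\boldsymbol\pi}(n)-\boldsymbol\pi\}\xrightarrow{d}\mathbf W_{\boldsymbol\pi}:=\boldsymbol\pi\mathbf W(\mathbf I_s-\mathbf P+\mathbf A)^{-1}.$$ Moreover, if $\mathbf M_{\boldsymbol\pi^\top}=\boldsymbol\pi\otimes(\mathbf I_s-\mathbf P^\top+\mathbf A)^{-1}$, then $$\operatorname{vec}(\mathbf W_{\boldsymbol\pi}^\top)=\mathbf M_{\boldsymbol\pi^\top}\mathbf W_{\mathbf p}\sim\mathcal N_s\big(\mathbf 0_s,\ \mathbf M_{\boldsymbol\pi^\top}\mathbf\Sigma_{\mathbf p}\mathbf M_{\boldsymbol\pi^\top}^\top\big).$$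
   Context: $(X_m)_{m\ge0}$ is a time-homogeneous Markov chain on $\{1,\ldots,s\}$ with irreducible transition matrix $\mathbf P=(p_{ij})$ and stationary row vector $\boldsymbol\pi=(\pi_1,\ldots,\pi_s)$, observed along a single trajectory $X_0,\ldots,X_n$. $N_{ij}(n)$ is the number of transitions from $i$ to $j$ up to time $n$, $N_i(n)=\sum_jN_{ij}(n)$, and $\widehat{\mathbf P}(n)$ has entries $N_{ij}(n)/N_i(n)$ (and $0$ if $N_i(n)=0$). Limits are as $n\to\infty$; $\xrightarrow{d}$ is convergence in distribution; strongly consistent means almost surely convergent to the true value. Plug-in quantities may be defined arbitrarily when the defining inverse does not exist at $\widehat{\mathbf P}(n)$. $\mathbf 1_s=(1,\ldots,1)^\top$. $\mathbf W=(W_{ij})$ is the centered Gaussian random $s\times s$ matrix with $\operatorname{Cov}(W_{ij},W_{kl})=\delta_{ik}\pi_i^{-1}p_{ij}(\delta_{jl}-p_{il})$. $\operatorname{vec}$ stacks columns, $\mathbf W_{\mathbf p}=\operatorname{vec}(\mathbf W^\top)$, and $\mathbf\Sigma_{\mathbf p}=\operatorname{Cov}(\mathbf W_{\mathbf p})$, i.e. the block diagonal matrix with blocks $\pi_i^{-1}\mathbf\Lambda_i$, $\mathbf\Lambda_i(j,k)=p_{ij}(\delta_{jk}-p_{ik})$. $\otimes$ is the Kronecker product. *)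

theory Defs
  imports "HOL-Probability.Probability"
begin

section \<open>Matrices\<close>

text \<open>Row vectors of length \<open>s\<close> are values of type \<^typ>\<open>real^'s\<close>, multiplied by
  matrices from the left with \<open>v*\<close>; \<open>rowvector\<close> turns them into matrices of shape
  \<open>1 \<times> s\<close> where a matrix is required. The vector \<open>1 :: real^'s\<close> is the all-ones vector.\<close>

definition ones_mat :: "real^'s^'s" where
  "ones_mat = (columnvector 1 :: real^1^'s) ** (rowvector 1 :: real^'s^1)"

text \<open>The entries of \<open>vec A\<close> are indexed by pairs (column, row), so that reading the pairs
  lexicographically lists the columns of \<open>A\<close> one after the other. The Kronecker product is
  indexed by pairs in the same way.\<close>

definition vec_stack :: "real^'n^'m \<Rightarrow> real^('n \<times> 'm)" where
  "vec_stack A = (\<chi> c. A $ snd c $ fst c)"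

definition kron :: "real^'n^'m \<Rightarrow> real^'q^'p \<Rightarrow> real^('n \<times> 'q)^('m \<times> 'p)" where
  "kron A B = (\<chi> r c. A $ fst r $ fst c * B $ snd r $ snd c)"

definition stochastic_mat :: "real^'s^'s \<Rightarrow> bool" where
  "stochastic_mat P \<longleftrightarrow> (\<forall>i j. 0 \<le> P $ i $ j) \<and> (\<forall>i. (\<Sum>j\<in>UNIV. P $ i $ j) = 1)"

text \<open>The library's \<open>*\<close> and \<open>^\<close> on \<^typ>\<open>real^'s^'s\<close> are componentwise,
  hence the iteration of \<open>**\<close>.\<close>

definition mat_pow :: "real^'s^'s \<Rightarrow> nat \<Rightarrow> real^'s^'s" where
  "mat_pow P n = ((\<lambda>Q. P ** Q) ^^ n) (mat 1)"

definition irreducible_mat :: "real^'s^'s \<Rightarrow> bool" where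
  "irreducible_mat P \<longleftrightarrow> (\<forall>i j. \<exists>n. mat_pow P n $ i $ j > 0)"

definition stationary_dist :: "real^'s^'s \<Rightarrow> real^'s \<Rightarrow> bool" where
  "stationary_dist P p \<longleftrightarrow>
     (\<forall>i. 0 \<le> p $ i) \<and> (\<Sum>i\<in>UNIV. p $ i) = 1 \<and> p v* P = p"

section \<open>Markov chains and transition counts\<close>

definition markov_chain :: "'a measure \<Rightarrow> real^'s^'s \<Rightarrow> (nat \<Rightarrow> 'a \<Rightarrow> 's::finite) \<Rightarrow> bool" where
  "markov_chain M P X \<longleftrightarrow>
     prob_space M \<and> (\<forall>m. X m \<in> measurable M (count_space UNIV)) \<and>
     (\<forall>m h j. \<P>(\<omega> in M. \<forall>k\<le>m. X k \<omega> = h k) > 0 \<longrightarrow>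
        \<P>(\<omega> in M. X (Suc m) \<omega> = j \<bar> \<forall>k\<le>m. X k \<omega> = h k) = P $ h m $ j)"

definition trans_count :: "(nat \<Rightarrow> 'a \<Rightarrow> 's::finite) \<Rightarrow> nat \<Rightarrow> 'a \<Rightarrow> 's \<Rightarrow> 's \<Rightarrow> nat" where
  "trans_count X n \<omega> i j = card {m. m < n \<and> X m \<omega> = i \<and> X (Suc m) \<omega> = j}"

definition visit_count :: "(nat \<Rightarrow> 'a \<Rightarrow> 's::finite) \<Rightarrow> nat \<Rightarrow> 'a \<Rightarrow> 's \<Rightarrow> nat" where
  "visit_count X n \<omega> i = (\<Sum>j\<in>UNIV. trans_count X n \<omega> i j)"

definition P_hat :: "(nat \<Rightarrow> 'a \<Rightarrow> 's::finite) \<Rightarrow> nat \<Rightarrow> 'a \<Rightarrow> real^'s^'s" where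
  "P_hat X n \<omega> = (\<chi> i j. if visit_count X n \<omega> i = 0 then 0
     else real (trans_count X n \<omega> i j) / real (visit_count X n \<omega> i))"

section \<open>Convergence in distribution and Gaussian laws\<close>

definition conv_in_distr ::
  "'a measure \<Rightarrow> (nat \<Rightarrow> 'a \<Rightarrow> 'b::topological_space) \<Rightarrow> 'c measure \<Rightarrow> ('c \<Rightarrow> 'b) \<Rightarrow> bool" where
  "conv_in_distr M Y N Z \<longleftrightarrow>
     (\<forall>n. Y n \<in> borel_measurable M) \<and> Z \<in> borel_measurable N \<and>
     (\<forall>f :: 'b \<Rightarrow> real. continuous_on UNIV f \<and> bounded (range f) \<longrightarrow>
        (\<lambda>n. integral\<^sup>L M (\<lambda>\<omega>. f (Y n \<omega>))) \<longlonglongrightarrow> integral\<^sup>L N (\<lambda>\<omega>. f (Z \<omega>)))"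

text \<open>The normal law on the line with mean \<open>m\<close> and standard deviation \<open>\<sigma>\<close>; the
  degenerate case is the point mass.\<close>

definition normal_law :: "real \<Rightarrow> real \<Rightarrow> real measure" where
  "normal_law m \<sigma> = (if \<sigma> = 0 then return borel m
     else density lborel (\<lambda>x. ennreal (normal_density m \<sigma> x)))"

text \<open>Possibly degenerate Gaussian random elements of a Euclidean space, which covers both
  random vectors and random matrices.\<close>

definition gaussian_rv :: "'w measure \<Rightarrow> ('w \<Rightarrow> 'b::euclidean_space) \<Rightarrow> bool" where
  "gaussian_rv N Y \<longleftrightarrow> Y \<in> borel_measurable N \<and>
     (\<forall>t. \<exists>m \<sigma>. \<sigma> \<ge> 0 \<and> distr N borel (\<lambda>\<omega>. t \<bullet> Y \<omega>) = normal_law m \<sigma>)"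

definition covar :: "'w measure \<Rightarrow> ('w \<Rightarrow> real) \<Rightarrow> ('w \<Rightarrow> real) \<Rightarrow> real" where
  "covar N U V =
     integral\<^sup>L N (\<lambda>\<omega>. (U \<omega> - integral\<^sup>L N U) * (V \<omega> - integral\<^sup>L N V))"

definition covar_mat :: "'w measure \<Rightarrow> ('w \<Rightarrow> real^'n) \<Rightarrow> real^'n^'n" where
  "covar_mat N Y = (\<chi> i j. covar N (\<lambda>\<omega>. Y \<omega> $ i) (\<lambda>\<omega>. Y \<omega> $ j))"

definition mv_normal :: "'w measure \<Rightarrow> ('w \<Rightarrow> real^'n) \<Rightarrow> real^'n \<Rightarrow> real^'n^'n \<Rightarrow> bool" where
  "mv_normal N Y \<mu> S \<longleftrightarrow> gaussian_rv N Y \<and> integral\<^sup>L N Y = \<mu> \<and> covar_mat N Y = S"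

section \<open>The limiting Gaussian matrix\<close>

definition Lambda_block :: "real^'s^'s \<Rightarrow> 's \<Rightarrow> real^'s^'s" where
  "Lambda_block P i = (\<chi> j k. P $ i $ j * ((if j = k then 1 else 0) - P $ i $ k))"

definition W_matrix :: "'w measure \<Rightarrow> real^'s^'s \<Rightarrow> real^'s \<Rightarrow> ('w \<Rightarrow> real^'s^'s) \<Rightarrow> bool" where
  "W_matrix N P p W \<longleftrightarrow> prob_space N \<and> gaussian_rv N W \<and> integral\<^sup>L N W = 0 \<and>
     (\<forall>i j k l. covar N (\<lambda>\<omega>. W \<omega> $ i $ j) (\<lambda>\<omega>. W \<omega> $ k $ l) =
        (if i = k then 1 else 0) * (1 / p $ i) * P $ i $ j * ((if j = l then 1 else 0) - P $ i $ l))"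

definition Sigma_p :: "real^'s^'s \<Rightarrow> real^'s \<Rightarrow> real^('s \<times> 's)^('s \<times> 's)" where
  "Sigma_p P p = (\<chi> r c. if fst r = fst c
     then (1 / p $ fst r) * Lambda_block P (fst r) $ snd r $ snd c else 0)"

definition W_p :: "real^'s^'s \<Rightarrow> real^('s \<times> 's)" where
  "W_p W = vec_stack (transpose W)"

lemma Sigma_p_eq_covar_mat:
  assumes "W_matrix N P p W"
  shows "Sigma_p P p = covar_mat N (\<lambda>\<omega>. W_p (W \<omega>))"
  using assms
  by (simp add: vec_eq_iff Sigma_p_def covar_mat_def W_p_def vec_stack_def transpose_def
      W_matrix_def Lambda_block_def)

definition W_pi :: "real^'s^'s \<Rightarrow> real^'s \<Rightarrow> real^'s^'s \<Rightarrow> real^'s" where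
  "W_pi P p W = p v* W v* matrix_inv (mat 1 - P + ones_mat)"

definition M_pi :: "real^'s^'s \<Rightarrow> real^'s \<Rightarrow> real^('s \<times> 's)^(1 \<times> 's)" where
  "M_pi P p = kron (rowvector p) (matrix_inv (mat 1 - transpose P + ones_mat))"

end

theory Submission
  imports Defs "HOL-Library.Discrete_Functions"
begin

text \<open>
  The estimator is governed by the occupation fractions \<open>q n\<close>, the row of relative frequencies of
  the visited states. The path enters and leaves each state alternately, so \<open>q n\<close> is stationary for
  the estimated matrix up to an error of norm \<open>2 / n\<close>. Hence \<open>q n\<close> satisfies
  \<open>x (I - P_hat + A) = 1\<close> up to this error, while the estimator satisfies it exactly
  wherever the matrix is invertible. The law of large numbers makes this matrix converge almost
  surely to \<open>I - P + A\<close>, which is invertible by irreducibility, so the estimator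
  differs from \<open>q n\<close> by \<open>O(1 / n)\<close> almost surely (\<open>plug_in_close_to_occupation\<close>) and
  consistency and limit law need to be proved for \<open>q n\<close> only.

  For \<open>q n\<close>, Poisson's equation (\<open>occupation_deviation\<close>) writes \<open>n (q n - p) \<bullet> w\<close> as a sum of
  bounded martingale differences of the form \<open>u (X (k + 1)) - (P u) (X k)\<close> with
  \<open>u = (I - P + A)\<^sup>-\<^sup>1 w\<close>, plus two bounded end point terms. Orthogonality of the differences gives
  the strong law (\<open>path_sum_strong_law\<close>). For the central limit theorem
  (\<open>path_sum_clt_cos\<close>) the cosine of the normalised sum, shifted by a phase \<open>b\<close>, is multiplied by
  the exponential of half the accumulated conditional variance divided by \<open>n\<close>. The expectation of
  the product stays within \<open>O(1 / sqrt n)\<close> of \<open>cos b\<close>, and the exponent converges by the strong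
  law.

  Convergence of the expectations of all \<open>cos (t \<bullet> Y + b)\<close> together with tightness gives convergence in
  distribution in a Euclidean space (\<open>cramer_wold\<close>), by the Stone-Weierstrass theorem after a
  periodic change of variables. The limiting variance in direction \<open>t\<close> agrees with that of
  \<open>t \<bullet> p W (I - P + A)\<^sup>-\<^sup>1\<close>, computed from the covariances of \<open>W\<close> (\<open>W_pi_second_moment\<close>).
\<close>

section \<open>Stationary rows and the matrix I - P + A\<close>

lemma vector_matrix_ones: "x v* ones_mat = (\<Sum>i\<in>UNIV. x $ i) *\<^sub>R (1 :: real^'s)"
  by (simp add: vec_eq_iff ones_mat_def vector_matrix_mult_def matrix_matrix_mult_def
      columnvector_def rowvector_def)

lemma matrix_vector_ones: "ones_mat *v x = (\<Sum>i\<in>UNIV. x $ i) *\<^sub>R (1 :: real^'s)"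
  by (simp add: vec_eq_iff ones_mat_def matrix_vector_mult_def matrix_matrix_mult_def
      columnvector_def rowvector_def)

lemma stationary_mat_pow:
  assumes "p v* P = p"
  shows "p v* mat_pow P n = p"
  by (induction n) (auto simp: mat_pow_def vector_matrix_mul_assoc[symmetric] assms)

lemma mat_pow_nonneg:
  assumes "stochastic_mat P"
  shows "0 \<le> mat_pow P n $ i $ j"
proof (induction n arbitrary: i)
  case (Suc n)
  then show ?case
    using assms by (auto simp: mat_pow_def matrix_matrix_mult_def stochastic_mat_def intro!: sum_nonneg)
qed (simp add: mat_pow_def mat_def)

lemma stochastic_mat_mat_pow:
  assumes "stochastic_mat P"
  shows "mat_pow P n *v 1 = (1 :: real^'s)"
proof -
  have *: "P *v 1 = (1 :: real^'s)"
    using assms by (simp add: stochastic_mat_def matrix_vector_mult_def vec_eq_iff)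
  show ?thesis
    by (induction n) (auto simp: mat_pow_def matrix_vector_mul_assoc[symmetric] *)
qed

text \<open>Some state carries positive mass, and stationarity under a suitable power of \<open>P\<close> passes
  mass from it to any other state.\<close>

lemma stationary_dist_pos:
  assumes P: "stochastic_mat P" and irr: "irreducible_mat P" and p: "stationary_dist P p"
  shows "0 < p $ j"
proof -
  have nn: "0 \<le> p $ i" for i using p by (simp add: stationary_dist_def)
  have "\<exists>i. p $ i \<noteq> 0"
  proof (rule ccontr)
    assume "\<not> (\<exists>i. p $ i \<noteq> 0)"
    then have "(\<Sum>i\<in>UNIV. p $ i) = 0" by simp
    with p show False by (simp add: stationary_dist_def)
  qed
  then obtain i where i: "0 < p $ i" using nn by (metis less_eq_real_def)
  obtain n where n: "0 < mat_pow P n $ i $ j"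
    using irr by (auto simp: irreducible_mat_def)
  have "0 < p $ i * mat_pow P n $ i $ j" using i n by simp
  also have "\<dots> \<le> (\<Sum>k\<in>UNIV. p $ k * mat_pow P n $ k $ j)"
    by (rule member_le_sum) (auto intro!: mult_nonneg_nonneg nn mat_pow_nonneg[OF P])
  also have "\<dots> = (p v* mat_pow P n) $ j"
    by (simp add: vector_matrix_mult_def mult.commute)
  also have "\<dots> = p $ j"
    using p by (subst stationary_mat_pow) (auto simp: stationary_dist_def)
  finally show ?thesis .
qed

text \<open>The maximum principle: at a state where a harmonic function is maximal it is a weighted
  average of values that do not exceed the maximum, so all states that can be reached carry the
  same value.\<close>

lemma harmonic_constant:
  fixes x :: "real^'s"
  assumes P: "stochastic_mat P" and irr: "irreducible_mat P" and x: "P *v x = x"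
  obtains c where "x = c *\<^sub>R 1"
proof -
  obtain i where i: "\<And>j. x $ j \<le> x $ i"
  proof -
    have fin: "finite (range (\<lambda>j. x $ j))" by simp
    have "Max (range (\<lambda>j. x $ j)) \<in> range (\<lambda>j. x $ j)" by (rule Max_in) auto
    then obtain i where "x $ i = Max (range (\<lambda>j. x $ j))" by (metis imageE)
    then show thesis using that[of i] Max_ge[OF fin] by auto
  qed
  have pow: "mat_pow P n *v x = x" for n
    by (induction n) (auto simp: mat_pow_def matrix_vector_mul_assoc[symmetric] x)
  have "x $ j = x $ i" for j
  proof -
    obtain n where n: "0 < mat_pow P n $ i $ j"
      using irr by (auto simp: irreducible_mat_def)
    have "(\<Sum>k\<in>UNIV. mat_pow P n $ i $ k * (x $ i - x $ k))
        = (mat_pow P n *v 1) $ i * x $ i - (mat_pow P n *v x) $ i"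
      by (simp add: matrix_vector_mult_def algebra_simps sum_subtractf sum_distrib_left)
    also have "\<dots> = 0" by (simp add: pow stochastic_mat_mat_pow[OF P])
    finally have "\<forall>k\<in>UNIV. mat_pow P n $ i $ k * (x $ i - x $ k) = 0"
      by (subst (asm) sum_nonneg_eq_0_iff)
        (auto intro!: mult_nonneg_nonneg mat_pow_nonneg[OF P] simp: i)
    then have "mat_pow P n $ i $ j * (x $ i - x $ j) = 0" by blast
    with n show ?thesis by simp
  qed
  then have "x = (x $ i) *\<^sub>R 1" by (simp add: vec_eq_iff)
  then show thesis by (rule that)
qed

text \<open>If \<open>(I - P + A) x = 0\<close>, multiplication by \<open>p\<close> from the left kills the part
  \<open>I - P\<close>, so the entries of \<open>x\<close> sum to zero; then \<open>x\<close> is harmonic, hence constant, hence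
  zero.\<close>

lemma invertible_fundamental:
  fixes P :: "real^'s^'s"
  assumes P: "stochastic_mat P" and irr: "irreducible_mat P" and p: "stationary_dist P p"
  shows "invertible (mat 1 - P + ones_mat)"
proof -
  have "x = 0" if x: "(mat 1 - P + ones_mat) *v x = 0" for x :: "real^'s"
  proof -
    define s where "s = (\<Sum>i\<in>UNIV. x $ i)"
    have pP: "p v* P = p" and p1: "p \<bullet> 1 = 1"
      using p by (auto simp: stationary_dist_def inner_vec_def)
    have eq: "x - P *v x + s *\<^sub>R 1 = 0"
      using x by (simp add: matrix_vector_mult_add_rdistrib matrix_vector_mult_diff_rdistrib
          matrix_vector_ones s_def)
    have "p \<bullet> x - p \<bullet> (P *v x) + s * (p \<bullet> 1) = 0"
      using arg_cong[OF eq, of "\<lambda>y. p \<bullet> y"] by (simp add: inner_add_right inner_diff_right)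
    then have s: "s = 0"
      by (simp add: dot_lmul_matrix[symmetric] pP p1)
    with eq have "P *v x = x" by simp
    then obtain c where c: "x = c *\<^sub>R 1" using harmonic_constant[OF P irr] by blast
    have "s = real CARD('s) * c" by (simp add: s_def c)
    with s have "c = 0" by simp
    with c show ?thesis by simp
  qed
  then show ?thesis
    by (simp add: invertible_left_inverse matrix_left_invertible_ker)
qed

lemma matrix_inv_mult:
  fixes A :: "real^'n^'n"
  assumes "invertible A"
  shows "A ** matrix_inv A = mat 1" "matrix_inv A ** A = mat 1"
proof -
  have "\<exists>B. A ** B = mat 1 \<and> B ** A = mat 1" using assms by (simp add: invertible_def)
  then have "A ** matrix_inv A = mat 1 \<and> matrix_inv A ** A = mat 1"
    unfolding matrix_inv_def by (rule someI_ex)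
  then show "A ** matrix_inv A = mat 1" "matrix_inv A ** A = mat 1" by auto
qed

lemma row_equation_iff:
  fixes A :: "real^'n^'n"
  assumes "invertible A"
  shows "x v* A = y \<longleftrightarrow> x = y v* matrix_inv A"
  using matrix_inv_mult[OF assms] by (auto simp: vector_matrix_mul_assoc)

lemma matrix_inv_transpose:
  fixes A :: "real^'n^'n"
  assumes "invertible A"
  shows "matrix_inv (transpose A) = transpose (matrix_inv A)"
proof -
  have inv: "invertible (transpose A)" using assms by (simp add: transpose_invertible)
  have "transpose (matrix_inv A) ** transpose A = mat 1"
    by (simp add: matrix_transpose_mul[symmetric] matrix_inv_mult[OF assms] transpose_mat)
  then have "transpose (matrix_inv A) ** (transpose A ** matrix_inv (transpose A))
     = matrix_inv (transpose A)"
    by (simp add: matrix_mul_assoc)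
  then show ?thesis by (simp add: matrix_inv_mult[OF inv])
qed

lemma stationary_eq_inverse:
  fixes P :: "real^'s^'s"
  assumes P: "stochastic_mat P" and irr: "irreducible_mat P" and p: "stationary_dist P p"
  shows "p = 1 v* matrix_inv (mat 1 - P + ones_mat)"
proof -
  have "p v* (mat 1 - P + ones_mat) = 1"
    using p by (simp add: stationary_dist_def vector_matrix_mult_add_rdistrib
      vector_matrix_mult_diff_rdistrib vector_matrix_ones)
  then show ?thesis by (simp add: row_equation_iff[OF invertible_fundamental[OF P irr p]])
qed

lemma norm_vector_matrix_le:
  fixes A :: "real^'n^'m"
  shows "norm (x v* A) \<le> norm x * (\<Sum>i\<in>UNIV. norm (A $ i))"
proof -
  have "x v* A = (\<Sum>i\<in>UNIV. (x $ i) *\<^sub>R (A $ i))"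
    by (simp add: vec_eq_iff vector_matrix_mult_def mult.commute)
  also have "norm \<dots> \<le> (\<Sum>i\<in>UNIV. \<bar>x $ i\<bar> * norm (A $ i))"
    by (rule order_trans[OF norm_sum]) simp
  also have "\<dots> \<le> (\<Sum>i\<in>UNIV. norm x * norm (A $ i))"
    by (intro sum_mono mult_right_mono component_le_norm_cart) auto
  finally show ?thesis by (simp add: sum_distrib_left)
qed

text \<open>Writing \<open>x B = x B' + x (B - B')\<close> and absorbing the last term for \<open>B'\<close> close to \<open>B\<close>
  bounds the inverse of every matrix near an invertible \<open>B\<close> by one constant.\<close>

lemma eventually_inverse_bounded:
  fixes B :: "real^'n^'n" and C :: "nat \<Rightarrow> real^'n^'n"
  assumes B: "invertible B" and C: "C \<longlonglongrightarrow> B"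
  obtains K where "0 < K"
    "eventually (\<lambda>n. invertible (C n) \<and> (\<forall>x. norm x \<le> K * norm (x v* C n))) sequentially"
proof -
  define k where "k = 1 + (\<Sum>i\<in>UNIV. norm (matrix_inv B $ i))"
  have k: "0 < k" unfolding k_def by (intro add_pos_nonneg sum_nonneg) auto
  have lower: "norm x \<le> k * norm (x v* B)" for x
  proof -
    have "norm x = norm (x v* B v* matrix_inv B)"
      by (simp add: vector_matrix_mul_assoc matrix_inv_mult[OF B])
    also have "\<dots> \<le> norm (x v* B) * (\<Sum>i\<in>UNIV. norm (matrix_inv B $ i))"
      by (rule norm_vector_matrix_le)
    also have "\<dots> \<le> norm (x v* B) * k" by (intro mult_left_mono) (auto simp: k_def)
    finally show ?thesis by (simp add: mult.commute)
  qed
  have "(\<lambda>n. \<Sum>i\<in>UNIV. norm ((B - C n) $ i)) \<longlonglongrightarrow> (\<Sum>i\<in>UNIV. norm ((B - B) $ i))"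
    by (intro tendsto_intros C)
  then have "(\<lambda>n. \<Sum>i\<in>UNIV. norm ((B - C n) $ i)) \<longlonglongrightarrow> 0" by simp
  moreover have "0 < 1 / (2 * k)" using k by simp
  ultimately have "eventually (\<lambda>n. (\<Sum>i\<in>UNIV. norm ((B - C n) $ i)) < 1 / (2 * k)) sequentially"
    by (rule order_tendstoD)
  then have "eventually (\<lambda>n. invertible (C n) \<and> (\<forall>x. norm x \<le> (2 * k) * norm (x v* C n))) sequentially"
  proof (rule eventually_mono)
    fix n assume n: "(\<Sum>i\<in>UNIV. norm ((B - C n) $ i)) < 1 / (2 * k)"
    have *: "norm x \<le> (2 * k) * norm (x v* C n)" for x
    proof -
      have "x v* B = x v* C n + x v* (B - C n)" by (simp add: vector_matrix_mult_diff_rdistrib)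
      then have "norm (x v* B) \<le> norm (x v* C n) + norm (x v* (B - C n))"
        by (simp only: norm_triangle_ineq)
      also have "norm (x v* (B - C n)) \<le> norm x * (\<Sum>i\<in>UNIV. norm ((B - C n) $ i))"
        by (rule norm_vector_matrix_le)
      also have "\<dots> \<le> norm x * (1 / (2 * k))" using n by (intro mult_left_mono) auto
      finally have "k * norm (x v* B) \<le> k * (norm (x v* C n) + norm x * (1 / (2 * k)))"
        using k by (intro mult_left_mono) auto
      with lower[of x] have "norm x \<le> k * norm (x v* C n) + k * norm x * (1 / (2 * k))"
        by (simp add: algebra_simps)
      then show ?thesis using k by simp
    qed
    have "x = 0" if "transpose (C n) *v x = 0" for x
      using *[of x] that by simp
    then have "invertible (transpose (C n))"
      by (simp add: invertible_left_inverse matrix_left_invertible_ker)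
    then have "invertible (C n)" using transpose_invertible by fastforce
    with * show "invertible (C n) \<and> (\<forall>x. norm x \<le> (2 * k) * norm (x v* C n))" by blast
  qed
  then show thesis using that[of "2 * k"] k by simp
qed

section \<open>Transitions given the past and the strong law\<close>

lemma abs_le_sum_abs:
  fixes f :: "'s::finite \<Rightarrow> real"
  shows "\<bar>f i\<bar> \<le> (\<Sum>j\<in>UNIV. \<bar>f j\<bar>)"
  by (rule member_le_sum) auto

lemma abs_le_double_sum_abs:
  fixes f :: "'s::finite \<Rightarrow> 't::finite \<Rightarrow> real"
  shows "\<bar>f i j\<bar> \<le> (\<Sum>i\<in>UNIV. \<Sum>j\<in>UNIV. \<bar>f i j\<bar>)"
  by (rule order_trans[OF abs_le_sum_abs[of "f i"]], rule member_le_sum) (auto intro: sum_nonneg)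

definition path_sum :: "('s \<Rightarrow> 's \<Rightarrow> real) \<Rightarrow> (nat \<Rightarrow> 's) \<Rightarrow> nat \<Rightarrow> real" where
  "path_sum f x n = (\<Sum>k<n. f (x k) (x (Suc k)))"

lemma path_sum_0 [simp]: "path_sum f x 0 = 0"
  and path_sum_Suc [simp]: "path_sum f x (Suc n) = path_sum f x n + f (x n) (x (Suc n))"
  by (simp_all add: path_sum_def)

lemma path_sum_restrict: "n \<le> m \<Longrightarrow> path_sum f (restrict x {..m}) n = path_sum f x n"
  by (simp add: path_sum_def)

lemma markov_chain_measurable:
  assumes "markov_chain M P X"
  shows "X m \<in> measurable M (count_space UNIV)"
  using assms by (simp add: markov_chain_def)

lemma markov_chain_prob_space: "markov_chain M P X \<Longrightarrow> prob_space M"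
  by (simp add: markov_chain_def)

lemma path_event_sets:
  assumes "markov_chain M P X"
  shows "{\<omega> \<in> space M. \<forall>k\<le>m. X k \<omega> = h k} \<in> sets M"
    and "{\<omega> \<in> space M. X (Suc m) \<omega> = j \<and> (\<forall>k\<le>m. X k \<omega> = h k)} \<in> sets M"
proof -
  note [measurable] = markov_chain_measurable[OF assms]
  show "{\<omega> \<in> space M. \<forall>k\<le>m. X k \<omega> = h k} \<in> sets M"
    and "{\<omega> \<in> space M. X (Suc m) \<omega> = j \<and> (\<forall>k\<le>m. X k \<omega> = h k)} \<in> sets M"
    by measurable
qed

text \<open>Histories of probability zero, on which the conditional probability says nothing, satisfy the
  product formula trivially.\<close>

lemma path_transition_prob:
  assumes mc: "markov_chain M P X"
  shows "measure M {\<omega> \<in> space M. X (Suc m) \<omega> = j \<and> (\<forall>k\<le>m. X k \<omega> = h k)}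
       = measure M {\<omega> \<in> space M. \<forall>k\<le>m. X k \<omega> = h k} * P $ h m $ j"
    (is "measure M ?E = measure M ?F * _")
proof (cases "measure M ?F > 0")
  case True
  with mc have "measure M ?E / measure M ?F = P $ h m $ j"
    by (simp add: markov_chain_def cond_prob_def)
  with True show ?thesis by (simp add: field_simps)
next
  case False
  interpret prob_space M by (rule markov_chain_prob_space[OF mc])
  have "measure M ?E \<le> measure M ?F"
    by (rule finite_measure_mono[OF _ path_event_sets(1)[OF mc]]) blast
  moreover have "measure M ?F = 0" using False measure_nonneg[of M ?F] by linarith
  moreover have "0 \<le> measure M ?E" by (rule measure_nonneg)
  ultimately show ?thesis by simp
qed

text \<open>There are finitely many paths of a given length, so a function of such a path is a finite
  linear combination of indicators.\<close>

lemma path_function_decompose: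
  fixes X :: "nat \<Rightarrow> 'a \<Rightarrow> 's::finite" and F :: "(nat \<Rightarrow> 's) \<Rightarrow> real"
  assumes "\<omega> \<in> space M"
  shows "F (restrict (\<lambda>k. X k \<omega>) {..m}) =
    (\<Sum>h\<in>PiE {..m} (\<lambda>_. UNIV). F h * indicator {\<omega> \<in> space M. \<forall>k\<le>m. X k \<omega> = h k} \<omega>)"
proof -
  define r where "r = restrict (\<lambda>k. X k \<omega>) {..m}"
  have r: "r \<in> PiE {..m} (\<lambda>_. UNIV)" by (simp add: r_def)
  have *: "(indicator {\<omega> \<in> space M. \<forall>k\<le>m. X k \<omega> = h k} \<omega> :: real) = (if h = r then 1 else 0)"
    if "h \<in> PiE {..m} (\<lambda>_. UNIV)" for h
    using that assms by (auto simp: r_def indicator_def fun_eq_iff PiE_iff extensional_def)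
  have "(\<Sum>h\<in>PiE {..m} (\<lambda>_. UNIV). F h * indicator {\<omega> \<in> space M. \<forall>k\<le>m. X k \<omega> = h k} \<omega>)
     = (\<Sum>h\<in>PiE {..m} (\<lambda>_. UNIV). if h = r then F h else 0)"
    by (intro sum.cong refl) (simp add: *)
  also have "\<dots> = F r" using r by (simp add: sum.delta finite_PiE)
  finally show ?thesis by (simp add: r_def)
qed

lemma integrable_path_function:
  fixes X :: "nat \<Rightarrow> 'a \<Rightarrow> 's::finite" and G :: "(nat \<Rightarrow> 's) \<Rightarrow> real"
  assumes mc: "markov_chain M P X" and dep: "\<And>x. G (restrict x {..m}) = G x"
  shows "integrable M (\<lambda>\<omega>. G (\<lambda>k. X k \<omega>))"
proof -
  interpret prob_space M by (rule markov_chain_prob_space[OF mc])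
  have "integrable M (\<lambda>\<omega>. \<Sum>h\<in>PiE {..m} (\<lambda>_. UNIV).
      G h * indicator {\<omega> \<in> space M. \<forall>k\<le>m. X k \<omega> = h k} \<omega>)"
    by (intro Bochner_Integration.integrable_sum integrable_mult_right integrable_real_indicator
        path_event_sets[OF mc]) (simp add: emeasure_eq_measure)
  also have "?this \<longleftrightarrow> integrable M (\<lambda>\<omega>. G (\<lambda>k. X k \<omega>))"
    using path_function_decompose[of _ M G X m] by (intro Bochner_Integration.integrable_cong) (auto simp: dep)
  finally show ?thesis .
qed

text \<open>The Markov property in integrated form: given the past, the transition out of the current
  state is averaged with the row of \<open>P\<close> at that state.\<close>

lemma integral_one_step:
  fixes X :: "nat \<Rightarrow> 'a \<Rightarrow> 's::finite" and G :: "(nat \<Rightarrow> 's) \<Rightarrow> real"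
  assumes mc: "markov_chain M P X" and dep: "\<And>x. G (restrict x {..m}) = G x"
  shows "(\<integral>\<omega>. G (\<lambda>k. X k \<omega>) * g (X m \<omega>) (X (Suc m) \<omega>) \<partial>M)
       = (\<integral>\<omega>. G (\<lambda>k. X k \<omega>) * (\<Sum>j\<in>UNIV. P $ X m \<omega> $ j * g (X m \<omega>) j) \<partial>M)"
proof -
  interpret prob_space M by (rule markov_chain_prob_space[OF mc])
  let ?H = "PiE {..m} (\<lambda>_. UNIV :: 's set)"
  let ?F = "\<lambda>h. {\<omega> \<in> space M. \<forall>k\<le>m. X k \<omega> = h k}"
  let ?E = "\<lambda>h j. {\<omega> \<in> space M. X (Suc m) \<omega> = j \<and> (\<forall>k\<le>m. X k \<omega> = h k)}"
  have sets [simp]: "?F h \<in> sets M" "?E h j \<in> sets M" for h j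
    by (rule path_event_sets[OF mc])+
  have int: "integrable M (\<lambda>\<omega>. c * indicator A \<omega>)" "(\<integral>\<omega>. c * indicator A \<omega> \<partial>M) = c * measure M A"
    if "A \<in> sets M" for A and c :: real
    using that by (auto simp: emeasure_eq_measure)
  have "(\<integral>\<omega>. G (\<lambda>k. X k \<omega>) * g (X m \<omega>) (X (Suc m) \<omega>) \<partial>M)
      = (\<integral>\<omega>. (\<Sum>h\<in>?H. \<Sum>j\<in>UNIV. G h * g (h m) j * indicator (?E h j) \<omega>) \<partial>M)"
  proof (rule Bochner_Integration.integral_cong)
    fix \<omega> assume \<omega>: "\<omega> \<in> space M"
    have "G (\<lambda>k. X k \<omega>) * g (X m \<omega>) (X (Suc m) \<omega>)
       = (\<Sum>j\<in>UNIV. G (\<lambda>k. X k \<omega>) * g (X m \<omega>) j * of_bool (X (Suc m) \<omega> = j))"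
      by (simp add: of_bool_def if_distrib cong: if_cong)
    also have "\<dots> = (\<Sum>j\<in>UNIV. \<Sum>h\<in>?H. G h * g (h m) j * indicator (?F h) \<omega> * of_bool (X (Suc m) \<omega> = j))"
      using path_function_decompose[OF \<omega>, of "\<lambda>x. G x * g (x m) _" X m]
      by (intro sum.cong refl) (simp add: dep sum_distrib_right)
    also have "\<dots> = (\<Sum>h\<in>?H. \<Sum>j\<in>UNIV. G h * g (h m) j * indicator (?E h j) \<omega>)"
      using \<omega> by (subst sum.swap) (intro sum.cong refl, auto simp: indicator_def)
    finally show "G (\<lambda>k. X k \<omega>) * g (X m \<omega>) (X (Suc m) \<omega>)
      = (\<Sum>h\<in>?H. \<Sum>j\<in>UNIV. G h * g (h m) j * indicator (?E h j) \<omega>)" .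
  qed simp
  also have "\<dots> = (\<Sum>h\<in>?H. \<Sum>j\<in>UNIV. G h * g (h m) j * measure M (?E h j))"
    by (subst Bochner_Integration.integral_sum, (intro Bochner_Integration.integrable_sum int sets)[1])
      (subst Bochner_Integration.integral_sum, (intro Bochner_Integration.integrable_sum int sets)[1], simp only: int sets)
  also have "\<dots> = (\<Sum>h\<in>?H. G h * (\<Sum>j\<in>UNIV. P $ h m $ j * g (h m) j) * measure M (?F h))"
    by (intro sum.cong refl)
      (simp add: path_transition_prob[OF mc] sum_distrib_left sum_distrib_right ac_simps)
  also have "\<dots> = (\<integral>\<omega>. (\<Sum>h\<in>?H. G h * (\<Sum>j\<in>UNIV. P $ h m $ j * g (h m) j) * indicator (?F h) \<omega>) \<partial>M)"
    by (subst Bochner_Integration.integral_sum, (intro int sets)[1]) (simp only: int sets)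
  also have "\<dots> = (\<integral>\<omega>. G (\<lambda>k. X k \<omega>) * (\<Sum>j\<in>UNIV. P $ X m \<omega> $ j * g (X m \<omega>) j) \<partial>M)"
  proof (rule Bochner_Integration.integral_cong)
    fix \<omega> assume \<omega>: "\<omega> \<in> space M"
    show "(\<Sum>h\<in>?H. G h * (\<Sum>j\<in>UNIV. P $ h m $ j * g (h m) j) * indicator (?F h) \<omega>)
      = G (\<lambda>k. X k \<omega>) * (\<Sum>j\<in>UNIV. P $ X m \<omega> $ j * g (X m \<omega>) j)"
      using path_function_decompose[OF \<omega>, of "\<lambda>x. G x * (\<Sum>j\<in>UNIV. P $ x m $ j * g (x m) j)" X m]
      by (simp add: dep)
  qed simp
  finally show ?thesis .
qed

text \<open>The increments have mean zero given the past, hence are orthogonal, and the second moment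
  grows linearly.\<close>

lemma path_sum_second_moment:
  fixes X :: "nat \<Rightarrow> 'a \<Rightarrow> 's::finite" and f :: "'s \<Rightarrow> 's \<Rightarrow> real"
  assumes mc: "markov_chain M P X" and f0: "\<And>i. (\<Sum>j\<in>UNIV. P $ i $ j * f i j) = 0"
    and B: "\<And>i j. \<bar>f i j\<bar> \<le> B"
  shows "(\<integral>\<omega>. (path_sum f (\<lambda>k. X k \<omega>) n)\<^sup>2 \<partial>M) \<le> real n * B\<^sup>2"
proof (induction n)
  case (Suc n)
  interpret prob_space M by (rule markov_chain_prob_space[OF mc])
  let ?S = "\<lambda>\<omega>. path_sum f (\<lambda>k. X k \<omega>) n" and ?D = "\<lambda>\<omega>. f (X n \<omega>) (X (Suc n) \<omega>)"
  have i1: "integrable M (\<lambda>\<omega>. (?S \<omega>)\<^sup>2)"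
    by (rule integrable_path_function[OF mc, where G = "\<lambda>x. (path_sum f x n)\<^sup>2" and m = n]) (simp add: path_sum_restrict)
  have i2: "integrable M (\<lambda>\<omega>. ?S \<omega> * ?D \<omega>)"
    by (rule integrable_path_function[OF mc, where G = "\<lambda>x. path_sum f x n * f (x n) (x (Suc n))" and m = "Suc n"]) (simp add: path_sum_restrict)
  have i3: "integrable M (\<lambda>\<omega>. (?D \<omega>)\<^sup>2)"
    by (rule integrable_path_function[OF mc, where G = "\<lambda>x. (f (x n) (x (Suc n)))\<^sup>2" and m = "Suc n"]) (simp add: path_sum_restrict)
  have "(\<integral>\<omega>. ?S \<omega> * ?D \<omega> \<partial>M) = 0"
    by (subst integral_one_step[OF mc, where G = "\<lambda>x. path_sum f x n"]) (simp_all add: path_sum_restrict f0)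
  moreover have "(\<integral>\<omega>. (?D \<omega>)\<^sup>2 \<partial>M) \<le> B\<^sup>2"
    by (rule integral_le_const[OF i3]) (auto intro!: abs_le_square_iff[THEN iffD1] order_trans[OF B])
  moreover have "(\<integral>\<omega>. (path_sum f (\<lambda>k. X k \<omega>) (Suc n))\<^sup>2 \<partial>M)
     = (\<integral>\<omega>. (?S \<omega>)\<^sup>2 + 2 * (?S \<omega> * ?D \<omega>) + (?D \<omega>)\<^sup>2 \<partial>M)"
    by (simp add: power2_sum ac_simps)
  moreover have "\<dots> = (\<integral>\<omega>. (?S \<omega>)\<^sup>2 \<partial>M) + 2 * (\<integral>\<omega>. ?S \<omega> * ?D \<omega> \<partial>M) + (\<integral>\<omega>. (?D \<omega>)\<^sup>2 \<partial>M)"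
    using i1 i2 i3 by simp
  ultimately show ?case using Suc by (simp add: algebra_simps)
qed simp

text \<open>Along the squares the second moments are summable, so \<open>S (k\<^sup>2) / k\<^sup>2\<close> tends to zero; between
  consecutive squares a sum with bounded terms moves by at most \<open>2 k B\<close>.\<close>

theorem path_sum_strong_law:
  fixes X :: "nat \<Rightarrow> 'a \<Rightarrow> 's::finite" and f :: "'s \<Rightarrow> 's \<Rightarrow> real"
  assumes mc: "markov_chain M P X" and f0: "\<And>i. (\<Sum>j\<in>UNIV. P $ i $ j * f i j) = 0"
  shows "AE \<omega> in M. (\<lambda>n. path_sum f (\<lambda>k. X k \<omega>) n / real n) \<longlonglongrightarrow> 0"
proof -
  interpret prob_space M by (rule markov_chain_prob_space[OF mc])
  define B where "B = (\<Sum>i\<in>UNIV. \<Sum>j\<in>UNIV. \<bar>f i j\<bar>)"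
  have B: "\<bar>f i j\<bar> \<le> B" for i j unfolding B_def by (rule abs_le_double_sum_abs)
  then have B0: "0 \<le> B" using abs_ge_zero order_trans by blast
  let ?S = "\<lambda>\<omega>. path_sum f (\<lambda>k. X k \<omega>)"
  let ?a = "\<lambda>k \<omega>. (?S \<omega> (k\<^sup>2) / real (k\<^sup>2))\<^sup>2"
  have int: "integrable M (?a k)" for k
    by (rule integrable_path_function[OF mc, where G = "\<lambda>x. (path_sum f x (k\<^sup>2) / real (k\<^sup>2))\<^sup>2" and m = "k\<^sup>2"]) (simp add: path_sum_restrict)
  have bound: "(\<integral>\<omega>. ?a k \<omega> \<partial>M) \<le> B\<^sup>2 * (1 / real k ^ 2)" for k
  proof (cases "k = 0")
    case False
    have "(\<integral>\<omega>. ?a k \<omega> \<partial>M) = (\<integral>\<omega>. (?S \<omega> (k\<^sup>2))\<^sup>2 \<partial>M) / (real (k\<^sup>2))\<^sup>2"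
      by (simp add: power_divide)
    also have "\<dots> \<le> real (k\<^sup>2) * B\<^sup>2 / (real (k\<^sup>2))\<^sup>2"
      by (intro divide_right_mono path_sum_second_moment[OF mc f0 B]) auto
    finally show ?thesis using False by (simp add: field_simps power2_eq_square)
  qed simp
  have summ: "summable (\<lambda>k. B\<^sup>2 * (1 / real k ^ 2))"
    using inverse_power_summable[of 2, where 'a=real] by (intro summable_mult) (simp add: inverse_eq_divide)
  have "(\<integral>\<^sup>+\<omega>. (\<Sum>k. ennreal (?a k \<omega>)) \<partial>M) = (\<Sum>k. \<integral>\<^sup>+\<omega>. ennreal (?a k \<omega>) \<partial>M)"
    using int by (intro nn_integral_suminf) auto
  also have "\<dots> \<le> (\<Sum>k. ennreal (B\<^sup>2 * (1 / real k ^ 2)))"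
    using bound int by (intro suminf_le) (auto simp: nn_integral_eq_integral intro!: ennreal_leI)
  also have "\<dots> < \<infinity>"
    using summ by (subst suminf_ennreal_eq[where x = "\<Sum>k. B\<^sup>2 * (1 / real k ^ 2)"]) (auto simp: summable_sums)
  finally have "AE \<omega> in M. (\<Sum>k. ennreal (?a k \<omega>)) \<noteq> \<infinity>"
    using int by (intro nn_integral_PInf_AE) auto
  then show ?thesis
  proof (rule AE_mp, intro AE_I2 impI)
    fix \<omega> assume "(\<Sum>k. ennreal (?a k \<omega>)) \<noteq> \<infinity>"
    then have "summable (\<lambda>k. ?a k \<omega>)" by (intro summable_suminf_not_top) auto
    then have "(\<lambda>k. ?a k \<omega>) \<longlonglongrightarrow> 0" by (rule summable_LIMSEQ_zero)
    then have sq: "(\<lambda>k. \<bar>?S \<omega> (k\<^sup>2) / real (k\<^sup>2)\<bar>) \<longlonglongrightarrow> 0"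
      using tendsto_real_sqrt by fastforce
    have fs: "filterlim floor_sqrt at_top sequentially"
      unfolding filterlim_at_top
    proof
      fix Z :: nat
      show "eventually (\<lambda>n. Z \<le> floor_sqrt n) sequentially"
        using eventually_ge_at_top[of "Z\<^sup>2"] by eventually_elim (simp add: le_floor_sqrt_iff)
    qed
    let ?u = "\<lambda>k. \<bar>?S \<omega> (k\<^sup>2) / real (k\<^sup>2)\<bar> + 2 * B * inverse (real k)"
    have "?u \<longlonglongrightarrow> 0 + 2 * B * 0"
      by (intro tendsto_intros sq lim_inverse_n)
    then have lim: "(\<lambda>n. ?u (floor_sqrt n)) \<longlonglongrightarrow> 0"
      using fs filterlim_compose by fastforce
    have incr: "\<bar>?S \<omega> (m + d) - ?S \<omega> m\<bar> \<le> real d * B" for m d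
    proof (induction d)
      case (Suc d)
      then show ?case using B[of "X (m + d) \<omega>" "X (Suc (m + d)) \<omega>"] by (simp add: algebra_simps)
    qed simp
    show "(\<lambda>n. ?S \<omega> n / real n) \<longlonglongrightarrow> 0"
    proof (rule tendsto_0_le[OF lim, where K = 1], rule eventually_sequentiallyI[of 1])
      fix n :: nat assume n: "1 \<le> n"
      define k where "k = floor_sqrt n"
      have k: "k\<^sup>2 \<le> n" unfolding k_def by (rule floor_sqrt_power2_le)
      moreover have "1 \<le> k" using n by (simp add: k_def le_floor_sqrt_iff)
      moreover have "n \<le> k\<^sup>2 + 2 * k"
        using Suc_floor_sqrt_power2_gt[of n] by (simp add: k_def power2_eq_square)
      ultimately have k: "k\<^sup>2 \<le> n" "1 \<le> k" "n \<le> k\<^sup>2 + 2 * k" by auto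
      obtain d where d: "n = k\<^sup>2 + d" "d \<le> 2 * k" using k by (metis le_iff_add add_le_cancel_left)
      have "\<bar>?S \<omega> n\<bar> \<le> \<bar>?S \<omega> (k\<^sup>2)\<bar> + real d * B" using incr[of "k\<^sup>2" d] d by auto
      also have "real d * B \<le> 2 * real k * B" using d(2) B0 by (intro mult_right_mono) linarith+
      finally have "\<bar>?S \<omega> n\<bar> / real n \<le> (\<bar>?S \<omega> (k\<^sup>2)\<bar> + 2 * real k * B) / real n"
        by (intro divide_right_mono) auto
      also have "\<dots> \<le> (\<bar>?S \<omega> (k\<^sup>2)\<bar> + 2 * real k * B) / real (k\<^sup>2)"
        using k B0 n by (intro divide_left_mono) (auto intro!: mult_pos_pos simp del: of_nat_power)
      also have "\<dots> = ?u k" using k by (simp add: field_simps power2_eq_square)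
      finally show "norm (?S \<omega> n / real n) \<le> norm (?u (floor_sqrt n)) * 1"
        by (simp add: k_def)
    qed
  qed
qed

section \<open>Occupation fractions and estimated transition probabilities\<close>

definition occupation :: "(nat \<Rightarrow> 's::finite) \<Rightarrow> nat \<Rightarrow> real^'s" where
  "occupation x n = (\<chi> i. (\<Sum>k<n. of_bool (x k = i)) / real n)"

text \<open>The martingale difference of \<open>u\<close> along the chain: the value after a transition minus its
  conditional expectation given the state before it.\<close>

definition increment :: "real^'s^'s \<Rightarrow> real^'s \<Rightarrow> 's \<Rightarrow> 's::finite \<Rightarrow> real" where
  "increment P u i j = u $ j - (P *v u) $ i"

lemma increment_mean_0:
  assumes "stochastic_mat P"
  shows "(\<Sum>j\<in>UNIV. P $ i $ j * increment P u i j) = 0"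
proof -
  have "(\<Sum>j\<in>UNIV. P $ i $ j * increment P u i j)
      = (\<Sum>j\<in>UNIV. P $ i $ j * u $ j) - (\<Sum>j\<in>UNIV. P $ i $ j) * (P *v u) $ i"
    by (simp add: increment_def right_diff_distrib sum_subtractf sum_distrib_right)
  then show ?thesis using assms by (simp add: stochastic_mat_def matrix_vector_mult_def)
qed

lemma sum_path_eq_occupation:
  "(\<Sum>k<n. v (x k)) / real n = (\<Sum>i\<in>UNIV. v i * occupation x n $ i)" for v :: "'s::finite \<Rightarrow> real"
proof -
  have "(\<Sum>k<n. v (x k)) = (\<Sum>k<n. \<Sum>i\<in>UNIV. v i * of_bool (x k = i))"
    by (simp add: of_bool_def if_distrib cong: if_cong)
  also have "\<dots> = (\<Sum>i\<in>UNIV. v i * (\<Sum>k<n. of_bool (x k = i)))"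
    by (subst sum.swap) (simp only: sum_distrib_left)
  finally show ?thesis by (simp add: occupation_def sum_divide_distrib)
qed

lemma sum_occupation: "0 < n \<Longrightarrow> (\<Sum>i\<in>UNIV. occupation x n $ i) = 1"
  using sum_path_eq_occupation[where v = "\<lambda>_. 1" and n = n and x = x] by simp

text \<open>Poisson's equation: with \<open>u = (I - P + A)\<^sup>-\<^sup>1 w\<close> the deviation of the occupation
  fractions from \<open>p\<close> in direction \<open>w\<close> is a sum of martingale increments up to the two end
  points of the path, because \<open>u (x (k + 1)) - u (x k)\<close> telescopes.\<close>

lemma occupation_deviation:
  fixes P :: "real^'s^'s" and p :: "real^'s"
  assumes P: "stochastic_mat P" and irr: "irreducible_mat P" and p: "stationary_dist P p"
    and n: "0 < n" and u: "u = matrix_inv (mat 1 - P + ones_mat) *v w"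
  shows "(occupation x n - p) \<bullet> w = (path_sum (increment P u) x n + u $ x 0 - u $ x n) / real n"
proof -
  have w: "w = (mat 1 - P + ones_mat) *v u"
    by (simp add: u matrix_vector_mul_assoc matrix_inv_mult[OF invertible_fundamental[OF P irr p]])
  have ones: "q \<bullet> (ones_mat *v u) = (\<Sum>i\<in>UNIV. u $ i)" if "(\<Sum>i\<in>UNIV. q $ i) = 1" for q :: "real^'s"
    using that by (simp add: matrix_vector_ones inner_vec_def sum_distrib_left[symmetric]
      sum_distrib_right[symmetric])
  have "p \<bullet> w = p \<bullet> u - p \<bullet> (P *v u) + p \<bullet> (ones_mat *v u)"
    by (simp add: w matrix_vector_mult_add_rdistrib matrix_vector_mult_diff_rdistrib
        inner_add_right inner_diff_right)
  also have "\<dots> = (\<Sum>i\<in>UNIV. u $ i)"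
  proof -
    have "p \<bullet> (ones_mat *v u) = (\<Sum>i\<in>UNIV. u $ i)" using p by (intro ones) (simp add: stationary_dist_def)
    then show ?thesis using p by (simp add: dot_lmul_matrix[of p P u, symmetric] stationary_dist_def)
  qed
  finally have pw: "p \<bullet> w = (\<Sum>i\<in>UNIV. u $ i)" .
  have "occupation x n \<bullet> w = occupation x n \<bullet> (u - P *v u) + occupation x n \<bullet> (ones_mat *v u)"
    by (simp add: w matrix_vector_mult_add_rdistrib matrix_vector_mult_diff_rdistrib inner_add_right)
  also have "occupation x n \<bullet> (u - P *v u) = (\<Sum>k<n. u $ x k - (P *v u) $ x k) / real n"
    using sum_path_eq_occupation[where v = "\<lambda>i. u $ i - (P *v u) $ i" and n = n and x = x]
    by (simp add: inner_vec_def mult.commute)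
  also have "(\<Sum>k<n. u $ x k - (P *v u) $ x k) = path_sum (increment P u) x n + u $ x 0 - u $ x n"
    by (induction n) (simp_all add: increment_def)
  finally show ?thesis
    using n by (simp add: inner_diff_left pw ones sum_occupation)
qed

lemma occupation_strong_law:
  fixes X :: "nat \<Rightarrow> 'a \<Rightarrow> 's::finite"
  assumes P: "stochastic_mat P" and irr: "irreducible_mat P" and p: "stationary_dist P p"
    and mc: "markov_chain M P X"
  shows "AE \<omega> in M. occupation (\<lambda>k. X k \<omega>) \<longlonglongrightarrow> p"
proof -
  define u where "u i = matrix_inv (mat 1 - P + ones_mat) *v axis i 1" for i
  have "AE \<omega> in M. \<forall>i\<in>UNIV. (\<lambda>n. path_sum (increment P (u i)) (\<lambda>k. X k \<omega>) n / real n) \<longlonglongrightarrow> 0"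
    by (intro AE_finite_allI path_sum_strong_law[OF mc] increment_mean_0[OF P]) auto
  then show ?thesis
  proof (rule AE_mp, intro AE_I2 impI)
    fix \<omega>
    assume *: "\<forall>i\<in>UNIV. (\<lambda>n. path_sum (increment P (u i)) (\<lambda>k. X k \<omega>) n / real n) \<longlonglongrightarrow> 0"
    let ?x = "\<lambda>k. X k \<omega>"
    have "(\<lambda>n. occupation ?x n $ i) \<longlonglongrightarrow> p $ i" for i
    proof -
      define C where "C = (\<Sum>j\<in>UNIV. \<bar>u i $ j\<bar>)"
      have C: "\<bar>u i $ j\<bar> \<le> C" for j unfolding C_def by (rule abs_le_sum_abs)
      have "(\<lambda>n. \<bar>path_sum (increment P (u i)) ?x n / real n\<bar> + 2 * C * inverse (real n)) \<longlonglongrightarrow> 0 + 2 * C * 0"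
        using * by (intro tendsto_intros lim_inverse_n tendsto_rabs_zero) auto
      then have lim: "(\<lambda>n. \<bar>path_sum (increment P (u i)) ?x n / real n\<bar> + 2 * C * inverse (real n)) \<longlonglongrightarrow> 0"
        by simp
      have "(\<lambda>n. occupation ?x n $ i - p $ i) \<longlonglongrightarrow> 0"
      proof (rule tendsto_0_le[OF lim, where K = 1], rule eventually_sequentiallyI[of 1])
        fix n :: nat assume n: "1 \<le> n"
        have "occupation ?x n $ i - p $ i = (occupation ?x n - p) \<bullet> axis i 1"
          by (simp add: inner_axis)
        also have "\<dots> = path_sum (increment P (u i)) ?x n / real n + (u i $ ?x 0 - u i $ ?x n) / real n"
          using n by (subst occupation_deviation[OF P irr p _ u_def]) (simp_all add: add_divide_distrib diff_divide_distrib)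
        also have "\<bar>\<dots>\<bar> \<le> \<bar>path_sum (increment P (u i)) ?x n / real n\<bar> + \<bar>(u i $ ?x 0 - u i $ ?x n) / real n\<bar>"
          by (rule abs_triangle_ineq)
        also have "\<bar>(u i $ ?x 0 - u i $ ?x n) / real n\<bar> \<le> 2 * C / real n"
          using C[of "?x 0"] C[of "?x n"] by (simp add: divide_right_mono)
        finally show "norm (occupation ?x n $ i - p $ i)
          \<le> norm (\<bar>path_sum (increment P (u i)) ?x n / real n\<bar> + 2 * C * inverse (real n)) * 1"
          by (simp add: divide_inverse)
      qed
      then show ?thesis by (simp add: LIM_zero_iff)
    qed
    then show "occupation ?x \<longlonglongrightarrow> p" by (intro vec_tendstoI)
  qed
qed

lemma real_trans_count:
  "real (trans_count X n \<omega> i j) = (\<Sum>k<n. of_bool (X k \<omega> = i) * of_bool (X (Suc k) \<omega> = j))"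
proof -
  have "(\<Sum>k<n. of_bool (X k \<omega> = i \<and> X (Suc k) \<omega> = j)) = real (trans_count X n \<omega> i j)"
    by (subst sum_of_bool_eq) (auto simp: trans_count_def intro!: arg_cong[where f = card])
  then show ?thesis by (simp only: of_bool_conj)
qed

lemma real_visit_count:
  "real (visit_count X n \<omega> i) = (\<Sum>k<n. of_bool (X k \<omega> = i))"
proof -
  have "real (visit_count X n \<omega> i) = (\<Sum>j\<in>UNIV. \<Sum>k<n. of_bool (X k \<omega> = i) * of_bool (X (Suc k) \<omega> = j))"
    unfolding visit_count_def of_nat_sum real_trans_count ..
  also have "\<dots> = (\<Sum>k<n. of_bool (X k \<omega> = i) * (\<Sum>j\<in>UNIV. of_bool (X (Suc k) \<omega> = j)))"
    by (subst sum.swap) (simp only: sum_distrib_left)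
  also have "\<dots> = (\<Sum>k<n. of_bool (X k \<omega> = i))"
    by (intro sum.cong refl) (simp add: of_bool_def)
  finally show ?thesis .
qed

lemma occupation_P_hat:
  "occupation (\<lambda>k. X k \<omega>) n $ i * P_hat X n \<omega> $ i $ j = real (trans_count X n \<omega> i j) / real n"
proof (cases "visit_count X n \<omega> i = 0")
  case True
  then have "trans_count X n \<omega> i j = 0" by (simp add: visit_count_def)
  then show ?thesis using True by (simp add: P_hat_def)
next
  case False
  then show ?thesis by (simp add: P_hat_def occupation_def real_visit_count[symmetric])
qed

text \<open>The error of row \<open>i\<close> is a sum of martingale increments divided by the number of visits to
  \<open>i\<close>, and that number grows linearly because \<open>p $ i\<close> is positive.\<close>

lemma P_hat_strong_law:
  fixes X :: "nat \<Rightarrow> 'a \<Rightarrow> 's::finite"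
  assumes P: "stochastic_mat P" and irr: "irreducible_mat P" and p: "stationary_dist P p"
    and mc: "markov_chain M P X"
  shows "AE \<omega> in M. (\<lambda>n. P_hat X n \<omega>) \<longlonglongrightarrow> P"
proof -
  define g where "g i j a b = of_bool (a = i) * (of_bool (b = j) - P $ i $ j)" for i j a b
  have g0: "(\<Sum>b\<in>UNIV. P $ a $ b * g i j a b) = 0" for i j a
  proof (cases "a = i")
    case True
    have "P $ i $ b * g i j i b = (if b = j then P $ i $ j else 0) - P $ i $ b * P $ i $ j" for b
      by (simp add: g_def right_diff_distrib)
    then have "(\<Sum>b\<in>UNIV. P $ i $ b * g i j i b) = P $ i $ j - (\<Sum>b\<in>UNIV. P $ i $ b) * P $ i $ j"
      by (simp add: sum_subtractf sum_distrib_right)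
    with True P show ?thesis by (simp add: stochastic_mat_def)
  qed (simp add: g_def)
  have "AE \<omega> in M. \<forall>i\<in>UNIV. \<forall>j\<in>UNIV. (\<lambda>n. path_sum (g i j) (\<lambda>k. X k \<omega>) n / real n) \<longlonglongrightarrow> 0"
    by (intro AE_finite_allI path_sum_strong_law[OF mc] g0) auto
  with occupation_strong_law[OF P irr p mc] show ?thesis
  proof (eventually_elim, intro vec_tendstoI)
    fix \<omega> i j
    assume occ: "occupation (\<lambda>k. X k \<omega>) \<longlonglongrightarrow> p"
      and *: "\<forall>i\<in>UNIV. \<forall>j\<in>UNIV. (\<lambda>n. path_sum (g i j) (\<lambda>k. X k \<omega>) n / real n) \<longlonglongrightarrow> 0"
    let ?q = "\<lambda>n. occupation (\<lambda>k. X k \<omega>) n $ i"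
    have q: "?q \<longlonglongrightarrow> p $ i" using occ by (rule tendsto_vec_nth)
    have pos: "0 < p $ i" by (rule stationary_dist_pos[OF P irr p])
    have "(\<lambda>n. P $ i $ j + path_sum (g i j) (\<lambda>k. X k \<omega>) n / real n / ?q n) \<longlonglongrightarrow> P $ i $ j + 0 / p $ i"
      using * pos by (intro tendsto_intros q) auto
    moreover have "eventually (\<lambda>n. P $ i $ j + path_sum (g i j) (\<lambda>k. X k \<omega>) n / real n / ?q n = P_hat X n \<omega> $ i $ j) sequentially"
      using order_tendstoD(1)[OF q pos]
    proof eventually_elim
      case (elim n)
      have "path_sum (g i j) (\<lambda>k. X k \<omega>) n = real (trans_count X n \<omega> i j) - P $ i $ j * (\<Sum>k<n. of_bool (X k \<omega> = i))"
        by (simp add: path_sum_def g_def real_trans_count right_diff_distrib sum_subtractf sum_distrib_left mult.commute)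
      then have "path_sum (g i j) (\<lambda>k. X k \<omega>) n / real n = ?q n * P_hat X n \<omega> $ i $ j - P $ i $ j * ?q n"
        by (simp add: occupation_P_hat diff_divide_distrib) (simp add: occupation_def)
      with elim show ?case by (simp add: diff_divide_distrib)
    qed
    ultimately show "(\<lambda>n. P_hat X n \<omega> $ i $ j) \<longlonglongrightarrow> P $ i $ j"
      by (simp add: tendsto_cong)
  qed
qed

text \<open>The occupation fractions are almost stationary for the estimated matrix: entries into a
  state and exits from it alternate, so that their numbers differ by at most one.\<close>

lemma occupation_almost_stationary:
  fixes X :: "nat \<Rightarrow> 'a \<Rightarrow> 's::finite"
  assumes n: "0 < n"
  shows "norm (occupation (\<lambda>k. X k \<omega>) n v* (mat 1 - P_hat X n \<omega> + ones_mat) - 1) \<le> 2 / real n"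
proof -
  let ?q = "occupation (\<lambda>k. X k \<omega>) n"
  have "(?q - ?q v* P_hat X n \<omega>) $ j = ((axis (X 0 \<omega>) 1 - axis (X n \<omega>) 1) /\<^sub>R real n) $ j" for j
  proof -
    have "(?q v* P_hat X n \<omega>) $ j = (\<Sum>i\<in>UNIV. real (trans_count X n \<omega> i j)) / real n"
      by (simp add: vector_matrix_mult_def mult.commute[of "P_hat X n \<omega> $ _ $ _"] occupation_P_hat sum_divide_distrib)
    also have "(\<Sum>i\<in>UNIV. real (trans_count X n \<omega> i j)) = (\<Sum>k<n. of_bool (X (Suc k) \<omega> = j))"
      unfolding real_trans_count by (subst sum.swap) (simp add: sum_distrib_right[symmetric] of_bool_def)
    finally have "(?q - ?q v* P_hat X n \<omega>) $ j
       = ((\<Sum>k<n. of_bool (X k \<omega> = j)) - (\<Sum>k<n. of_bool (X (Suc k) \<omega> = j))) / real n"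
      by (simp add: occupation_def diff_divide_distrib)
    also have "(\<Sum>k<n. of_bool (X k \<omega> = j)) - (\<Sum>k<n. of_bool (X (Suc k) \<omega> = j))
      = (of_bool (X 0 \<omega> = j) - of_bool (X n \<omega> = j) :: real)"
      by (induction n) simp_all
    finally show ?thesis by (auto simp: axis_def divide_inverse)
  qed
  then have "?q - ?q v* P_hat X n \<omega> = (axis (X 0 \<omega>) 1 - axis (X n \<omega>) 1) /\<^sub>R real n"
    by (simp only: vec_eq_iff) simp
  moreover have "?q v* (mat 1 - P_hat X n \<omega> + ones_mat) - 1 = ?q - ?q v* P_hat X n \<omega>"
    using n by (simp add: vector_matrix_mult_add_rdistrib vector_matrix_mult_diff_rdistrib
        vector_matrix_ones sum_occupation)
  moreover have "norm (axis (X 0 \<omega>) 1 - axis (X n \<omega>) 1 :: real^'s) \<le> 2"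
    using norm_triangle_ineq4[of "axis (X 0 \<omega>) 1 :: real^'s" "axis (X n \<omega>) 1"] by simp
  ultimately show ?thesis by (simp add: divide_inverse mult.commute[of _ "inverse (real n)"] mult_left_mono)
qed

text \<open>Both rows solve, exactly or up to an error of order \<open>1 / n\<close>, the same linear system with
  matrix \<open>I - P_hat + A\<close>; this matrix is close to an invertible one, so its inverse stays bounded.\<close>

lemma plug_in_close_to_occupation:
  fixes X :: "nat \<Rightarrow> 'a \<Rightarrow> 's::finite"
  assumes P: "stochastic_mat P" and irr: "irreducible_mat P" and p: "stationary_dist P p"
    and mc: "markov_chain M P X"
    and p_hat: "\<And>n \<omega>. \<omega> \<in> space M \<Longrightarrow> invertible (mat 1 - P_hat X n \<omega> + ones_mat) \<Longrightarrow>
           p_hat n \<omega> = 1 v* matrix_inv (mat 1 - P_hat X n \<omega> + ones_mat)"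
  shows "AE \<omega> in M. \<exists>K. eventually (\<lambda>n. norm (p_hat n \<omega> - occupation (\<lambda>k. X k \<omega>) n) \<le> K / real n) sequentially"
  using P_hat_strong_law[OF P irr p mc] AE_space
proof eventually_elim
  fix \<omega>
  assume lim: "(\<lambda>n. P_hat X n \<omega>) \<longlonglongrightarrow> P" and \<omega>: "\<omega> \<in> space M"
  let ?C = "\<lambda>n. mat 1 - P_hat X n \<omega> + ones_mat" and ?q = "occupation (\<lambda>k. X k \<omega>)"
  have "?C \<longlonglongrightarrow> mat 1 - P + ones_mat" by (intro tendsto_intros lim)
  then obtain K where K: "0 < K"
    and ev: "eventually (\<lambda>n. invertible (?C n) \<and> (\<forall>x. norm x \<le> K * norm (x v* ?C n))) sequentially"
    using eventually_inverse_bounded[OF invertible_fundamental[OF P irr p]] by blast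
  have "eventually (\<lambda>n. norm (p_hat n \<omega> - ?q n) \<le> (K * 2) / real n) sequentially"
    using ev eventually_gt_at_top[of 0]
  proof eventually_elim
    case (elim n)
    have "p_hat n \<omega> v* ?C n = 1"
      using elim p_hat[OF \<omega>] by (subst row_equation_iff) auto
    then have "(p_hat n \<omega> - ?q n) v* ?C n = - (?q n v* ?C n - 1)"
      by (simp add: vector_matrix_mult_diff_distrib)
    then have "norm ((p_hat n \<omega> - ?q n) v* ?C n) \<le> 2 / real n"
      using occupation_almost_stationary[OF elim(2), of X \<omega>] by (simp only: norm_minus_cancel)
    then have "K * norm ((p_hat n \<omega> - ?q n) v* ?C n) \<le> K * (2 / real n)"
      using K by (intro mult_left_mono) auto
    with elim show ?case by (auto intro: order_trans)
  qed
  then show "\<exists>K. eventually (\<lambda>n. norm (p_hat n \<omega> - ?q n) \<le> K / real n) sequentially" by blast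
qed

lemma plug_in_strong_law:
  fixes X :: "nat \<Rightarrow> 'a \<Rightarrow> 's::finite"
  assumes P: "stochastic_mat P" and irr: "irreducible_mat P" and p: "stationary_dist P p"
    and mc: "markov_chain M P X"
    and p_hat: "\<And>n \<omega>. \<omega> \<in> space M \<Longrightarrow> invertible (mat 1 - P_hat X n \<omega> + ones_mat) \<Longrightarrow>
           p_hat n \<omega> = 1 v* matrix_inv (mat 1 - P_hat X n \<omega> + ones_mat)"
  shows "AE \<omega> in M. (\<lambda>n. p_hat n \<omega>) \<longlonglongrightarrow> p"
proof -
  have "AE \<omega> in M. \<exists>K. eventually (\<lambda>n. norm (p_hat n \<omega> - occupation (\<lambda>k. X k \<omega>) n) \<le> K / real n) sequentially"
    by (rule plug_in_close_to_occupation[OF P irr p mc p_hat])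
  with occupation_strong_law[OF P irr p mc] show ?thesis
  proof eventually_elim
    case (elim \<omega>)
    then obtain K where K: "eventually (\<lambda>n. norm (p_hat n \<omega> - occupation (\<lambda>k. X k \<omega>) n) \<le> K / real n) sequentially"
      by blast
    have "(\<lambda>n. K * inverse (real n)) \<longlonglongrightarrow> K * 0" by (intro tendsto_intros lim_inverse_n)
    then have "(\<lambda>n. K / real n) \<longlonglongrightarrow> 0" by (simp only: divide_inverse mult_zero_right)
    with K have "(\<lambda>n. p_hat n \<omega> - occupation (\<lambda>k. X k \<omega>) n) \<longlonglongrightarrow> 0"
      by (rule Lim_null_comparison)
    from tendsto_add[OF this elim(1)] show ?case by simp
  qed
qed

section \<open>The central limit theorem for path sums\<close>

definition step_variance :: "real^'s^'s \<Rightarrow> ('s::finite \<Rightarrow> 's \<Rightarrow> real) \<Rightarrow> 's \<Rightarrow> real" where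
  "step_variance P f i = (\<Sum>j\<in>UNIV. P $ i $ j * (f i j)\<^sup>2)"

lemma step_variance_bounds:
  assumes P: "stochastic_mat P" and B: "\<And>i j. \<bar>f i j\<bar> \<le> B"
  shows "0 \<le> step_variance P f i" "step_variance P f i \<le> B\<^sup>2"
proof -
  have P0: "0 \<le> P $ i $ j" for j using P by (simp add: stochastic_mat_def)
  show "0 \<le> step_variance P f i" unfolding step_variance_def by (intro sum_nonneg mult_nonneg_nonneg P0) simp
  have "(f i j)\<^sup>2 \<le> B\<^sup>2" for j using power_mono[OF B abs_ge_zero, of i j 2] by simp
  then have "step_variance P f i \<le> (\<Sum>j\<in>UNIV. P $ i $ j * B\<^sup>2)"
    unfolding step_variance_def by (intro sum_mono mult_left_mono P0)
  also have "\<dots> = B\<^sup>2" using P by (simp add: sum_distrib_right[symmetric] stochastic_mat_def)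
  finally show "step_variance P f i \<le> B\<^sup>2" .
qed

lemma cos_sin_taylor:
  fixes z :: real
  shows "\<bar>cos z - (1 - z\<^sup>2 / 2)\<bar> \<le> \<bar>z\<bar> ^ 3" "\<bar>sin z - z\<bar> \<le> \<bar>z\<bar> ^ 3"
proof -
  let ?d = "iexp z - (\<Sum>k \<le> 2. (\<i> * z)^k / fact k)"
  have "cmod ?d \<le> \<bar>z\<bar>^(Suc 2) / fact 2"
    by (rule order_trans[OF iexp_approx1]) (simp add: fact_numeral divide_left_mono)
  also have "\<dots> = \<bar>z\<bar> ^ 3 / 2" by (simp add: fact_numeral numeral_3_eq_3 numeral_2_eq_2)
  also have "\<dots> \<le> \<bar>z\<bar> ^ 3" by simp
  finally have *: "cmod ?d \<le> \<bar>z\<bar> ^ 3" .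
  have "?d = Complex (cos z - (1 - z\<^sup>2 / 2)) (sin z - z)"
    by (simp add: complex_eq_iff eval_nat_numeral fact_numeral Re_exp Im_exp)
  then have "Re ?d = cos z - (1 - z\<^sup>2 / 2)" "Im ?d = sin z - z" by simp_all
  with * abs_Re_le_cmod[of ?d] abs_Im_le_cmod[of ?d]
  show "\<bar>cos z - (1 - z\<^sup>2 / 2)\<bar> \<le> \<bar>z\<bar> ^ 3" "\<bar>sin z - z\<bar> \<le> \<bar>z\<bar> ^ 3" by simp_all
qed

lemma exp_mult_one_minus:
  fixes a :: real
  assumes "0 \<le> a"
  shows "\<bar>exp a * (1 - a) - 1\<bar> \<le> a\<^sup>2 * exp a"
proof -
  have e: "1 + a \<le> exp a" by (rule exp_ge_add_one_self)
  have "exp a * (1 - a) \<le> exp a * exp (- a)"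
    using exp_ge_add_one_self[of "- a"] by (intro mult_left_mono) auto
  then have up: "exp a * (1 - a) \<le> 1" by (simp add: exp_minus)
  have "0 \<le> 1 - a + a\<^sup>2" using zero_le_power2[of "a - 1/2"] by (simp add: power2_eq_square algebra_simps)
  then have "(1 - a + a\<^sup>2) * (1 + a) \<le> (1 - a + a\<^sup>2) * exp a" using e by (intro mult_left_mono)
  moreover have "(1 - a + a\<^sup>2) * (1 + a) = 1 + a ^ 3" by (simp add: eval_nat_numeral algebra_simps)
  moreover have "0 \<le> a ^ 3" using assms by simp
  ultimately have "1 \<le> (1 - a + a\<^sup>2) * exp a" by linarith
  then have "1 - exp a * (1 - a) \<le> a\<^sup>2 * exp a" by (simp add: algebra_simps)
  with up show ?thesis by simp
qed

text \<open>The first order term of the transition average vanishes and the exponential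
  compensates the second order term, so that only an error of order \<open>h\<^sup>3\<close> remains.\<close>

lemma compensated_step:
  fixes f :: "'s::finite \<Rightarrow> 's \<Rightarrow> real"
  assumes P: "stochastic_mat P" and f0: "\<And>i. (\<Sum>j\<in>UNIV. P $ i $ j * f i j) = 0"
    and B: "\<And>i j. \<bar>f i j\<bar> \<le> B" and h: "0 \<le> h" "h \<le> 1"
  defines "e \<equiv> \<lambda>i. exp (h\<^sup>2 / 2 * step_variance P f i)"
  shows "\<bar>e i * (\<Sum>j\<in>UNIV. P $ i $ j * cos (h * f i j)) - 1\<bar> \<le> exp (B\<^sup>2 / 2) * (B ^ 3 + B ^ 4) * h ^ 3"
    and "\<bar>e i * (\<Sum>j\<in>UNIV. P $ i $ j * sin (h * f i j))\<bar> \<le> exp (B\<^sup>2 / 2) * (B ^ 3 + B ^ 4) * h ^ 3"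
proof -
  define v where "v = step_variance P f i"
  define a where "a = h\<^sup>2 / 2 * v"
  have v: "0 \<le> v" "v \<le> B\<^sup>2" using step_variance_bounds[OF P B] by (auto simp: v_def)
  have B0: "0 \<le> B" using B[of undefined undefined] by linarith
  have P0: "0 \<le> P $ i $ j" for j using P by (simp add: stochastic_mat_def)
  have P1: "(\<Sum>j\<in>UNIV. P $ i $ j) = 1" using P by (simp add: stochastic_mat_def)
  have h2: "h\<^sup>2 \<le> 1" using h by (simp add: power_le_one)
  have a: "0 \<le> a" "a \<le> B\<^sup>2 / 2"
    using v mult_mono[OF h2 v(2)] h by (auto simp: a_def)
  have ea: "e i = exp a" by (simp add: e_def a_def v_def)
  have exp_le: "exp a \<le> exp (B\<^sup>2 / 2)" using a by simp
  have cube: "\<bar>h * f i j\<bar> ^ 3 \<le> h ^ 3 * B ^ 3" for j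
    using power_mono[OF B, of i j 3] h by (simp add: abs_mult power_mult_distrib mult_left_mono)
  have avg: "\<bar>\<Sum>j\<in>UNIV. P $ i $ j * g j\<bar> \<le> h ^ 3 * B ^ 3" if "\<And>j. \<bar>g j\<bar> \<le> \<bar>h * f i j\<bar> ^ 3" for g
  proof -
    have "\<bar>\<Sum>j\<in>UNIV. P $ i $ j * g j\<bar> \<le> (\<Sum>j\<in>UNIV. \<bar>P $ i $ j * g j\<bar>)" by (rule sum_abs)
    also have "\<dots> = (\<Sum>j\<in>UNIV. P $ i $ j * \<bar>g j\<bar>)" using P0 by (simp add: abs_mult)
    also have "\<dots> \<le> (\<Sum>j\<in>UNIV. P $ i $ j * (h ^ 3 * B ^ 3))"
      by (intro sum_mono mult_left_mono P0 order_trans[OF that cube])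
    also have "\<dots> = h ^ 3 * B ^ 3" by (simp only: sum_distrib_right[symmetric] P1 mult_1_left)
    finally show ?thesis .
  qed
  have sq: "(\<Sum>j\<in>UNIV. P $ i $ j * ((h * f i j)\<^sup>2 / 2)) = a"
    by (simp add: a_def v_def step_variance_def sum_distrib_left power_mult_distrib algebra_simps sum_divide_distrib)
  have "\<bar>\<Sum>j\<in>UNIV. P $ i $ j * (cos (h * f i j) - (1 - (h * f i j)\<^sup>2 / 2))\<bar> \<le> h ^ 3 * B ^ 3"
    by (rule avg) (rule cos_sin_taylor)
  also have "(\<Sum>j\<in>UNIV. P $ i $ j * (cos (h * f i j) - (1 - (h * f i j)\<^sup>2 / 2)))
     = (\<Sum>j\<in>UNIV. P $ i $ j * cos (h * f i j)) - ((\<Sum>j\<in>UNIV. P $ i $ j) - (\<Sum>j\<in>UNIV. P $ i $ j * ((h * f i j)\<^sup>2 / 2)))"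
    by (simp only: right_diff_distrib sum_subtractf mult_1_right)
  finally have c: "\<bar>(\<Sum>j\<in>UNIV. P $ i $ j * cos (h * f i j)) - (1 - a)\<bar> \<le> h ^ 3 * B ^ 3"
    by (simp only: sq P1)
  have "\<bar>\<Sum>j\<in>UNIV. P $ i $ j * (sin (h * f i j) - h * f i j)\<bar> \<le> h ^ 3 * B ^ 3"
    by (rule avg) (rule cos_sin_taylor)
  also have "(\<Sum>j\<in>UNIV. P $ i $ j * (sin (h * f i j) - h * f i j))
     = (\<Sum>j\<in>UNIV. P $ i $ j * sin (h * f i j)) - h * (\<Sum>j\<in>UNIV. P $ i $ j * f i j)"
    by (simp add: right_diff_distrib sum_subtractf sum_distrib_left ac_simps)
  finally have s: "\<bar>\<Sum>j\<in>UNIV. P $ i $ j * sin (h * f i j)\<bar> \<le> h ^ 3 * B ^ 3" by (simp add: f0)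
  \<comment> \<open>The sum \<open>B ^ 3 + B ^ 4\<close> serves both bounds: the cube comes from Taylor's remainder, the fourth
    power from the second order term \<open>a\<^sup>2\<close> of the exponential.\<close>
  have "\<bar>e i * (\<Sum>j\<in>UNIV. P $ i $ j * sin (h * f i j))\<bar> \<le> exp a * (h ^ 3 * B ^ 3)"
    using s by (simp add: ea abs_mult)
  also have "\<dots> \<le> exp (B\<^sup>2 / 2) * (h ^ 3 * (B ^ 3 + B ^ 4))"
    using h B0 exp_le by (intro mult_mono mult_left_mono) auto
  finally show "\<bar>e i * (\<Sum>j\<in>UNIV. P $ i $ j * sin (h * f i j))\<bar> \<le> exp (B\<^sup>2 / 2) * (B ^ 3 + B ^ 4) * h ^ 3"
    by (simp only: mult.assoc mult.commute[of "h ^ 3"])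
  have "a\<^sup>2 \<le> (h\<^sup>2 / 2 * B\<^sup>2)\<^sup>2" unfolding a_def using v by (intro power_mono mult_left_mono) auto
  also have "\<dots> = h ^ 3 * (h * B ^ 4 / 4)" by (simp add: eval_nat_numeral)
  also have "\<dots> \<le> h ^ 3 * B ^ 4"
  proof (intro mult_left_mono)
    show "h * B ^ 4 / 4 \<le> B ^ 4" using mult_right_mono[OF h(2), of "B ^ 4"] zero_le_power[OF B0, of 4] by linarith
  qed (use h in auto)
  finally have a2: "a\<^sup>2 \<le> h ^ 3 * B ^ 4" .
  have "e i * (\<Sum>j\<in>UNIV. P $ i $ j * cos (h * f i j)) - 1
      = exp a * ((\<Sum>j\<in>UNIV. P $ i $ j * cos (h * f i j)) - (1 - a)) + (exp a * (1 - a) - 1)"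
    by (simp add: ea algebra_simps)
  also have "\<bar>\<dots>\<bar> \<le> \<bar>exp a * ((\<Sum>j\<in>UNIV. P $ i $ j * cos (h * f i j)) - (1 - a))\<bar> + \<bar>exp a * (1 - a) - 1\<bar>"
    by (rule abs_triangle_ineq)
  also have "\<dots> \<le> exp a * (h ^ 3 * B ^ 3) + a\<^sup>2 * exp a"
    using c exp_mult_one_minus[OF a(1)] by (simp add: abs_mult add_mono)
  also have "\<dots> \<le> exp a * (h ^ 3 * B ^ 3) + (h ^ 3 * B ^ 4) * exp a"
    using a2 by simp
  also have "\<dots> = exp a * (h ^ 3 * (B ^ 3 + B ^ 4))" by (simp add: algebra_simps)
  also have "\<dots> \<le> exp (B\<^sup>2 / 2) * (h ^ 3 * (B ^ 3 + B ^ 4))"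
    using h B0 exp_le by (intro mult_right_mono) auto
  finally show "\<bar>e i * (\<Sum>j\<in>UNIV. P $ i $ j * cos (h * f i j)) - 1\<bar> \<le> exp (B\<^sup>2 / 2) * (B ^ 3 + B ^ 4) * h ^ 3"
    by (simp only: mult.assoc mult.commute[of "h ^ 3"])
qed

text \<open>By the addition formula for the cosine each transition changes the expectation only by the
  error of a compensated step, and these errors add up. The constraint on \<open>m\<close> keeps the exponential
  factor bounded.\<close>

lemma compensated_cos_near_constant:
  fixes X :: "nat \<Rightarrow> 'a \<Rightarrow> 's::finite" and f :: "'s \<Rightarrow> 's \<Rightarrow> real"
  assumes P: "stochastic_mat P" and mc: "markov_chain M P X"
    and f0: "\<And>i. (\<Sum>j\<in>UNIV. P $ i $ j * f i j) = 0"
    and B: "\<And>i j. \<bar>f i j\<bar> \<le> B" and h: "0 \<le> h" "h \<le> 1" and mh: "real m * h\<^sup>2 \<le> 1"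
  defines "V \<equiv> path_sum (\<lambda>i _. step_variance P f i)"
  shows "\<bar>(\<integral>\<omega>. exp (h\<^sup>2 / 2 * V (\<lambda>k. X k \<omega>) m) * cos (h * path_sum f (\<lambda>k. X k \<omega>) m + b) \<partial>M) - cos b\<bar>
    \<le> real m * (2 * exp (B\<^sup>2) * (B ^ 3 + B ^ 4) * h ^ 3)"
  using mh
proof (induction m)
  case 0
  interpret prob_space M by (rule markov_chain_prob_space[OF mc])
  show ?case by (simp add: V_def prob_space)
next
  case (Suc m)
  interpret prob_space M by (rule markov_chain_prob_space[OF mc])
  define e where "e i = exp (h\<^sup>2 / 2 * step_variance P f i)" for i
  define c where "c i = (\<Sum>j\<in>UNIV. P $ i $ j * cos (h * f i j))" for i
  define s where "s i = (\<Sum>j\<in>UNIV. P $ i $ j * sin (h * f i j))" for i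
  define E where "E x = exp (h\<^sup>2 / 2 * V x m)" for x
  define Y where "Y x = h * path_sum f x m + b" for x
  define K where "K = exp (B\<^sup>2 / 2) * (B ^ 3 + B ^ 4) * h ^ 3"
  have dep: "E (restrict x {..m}) = E x" "Y (restrict x {..m}) = Y x" for x
    by (simp_all add: E_def Y_def V_def path_sum_restrict)
  have B0: "0 \<le> B" using B[of undefined undefined] by linarith
  have int: "integrable M (\<lambda>\<omega>. F (\<lambda>k. X k \<omega>))" if "\<And>x. F (restrict x {..Suc m}) = F x" for F :: "(nat \<Rightarrow> 's) \<Rightarrow> real"
    by (rule integrable_path_function[OF mc, where G = F and m = "Suc m"]) (rule that)
  have dep': "E (restrict x {..Suc m}) = E x" "Y (restrict x {..Suc m}) = Y x" for x
    by (simp_all add: E_def Y_def V_def path_sum_restrict)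
  have E_le: "E x \<le> exp (B\<^sup>2 / 2)" for x
  proof -
    have "V x m \<le> (\<Sum>k<m. B\<^sup>2)"
      unfolding V_def path_sum_def by (intro sum_mono step_variance_bounds[OF P B])
    then have "h\<^sup>2 / 2 * V x m \<le> h\<^sup>2 / 2 * (real m * B\<^sup>2)" by (intro mult_left_mono) auto
    also have "\<dots> = (real m * h\<^sup>2) * (B\<^sup>2 / 2)" by simp
    also have "\<dots> \<le> 1 * (B\<^sup>2 / 2)"
    proof (rule mult_right_mono)
      have "real m * h\<^sup>2 \<le> real (Suc m) * h\<^sup>2" by (intro mult_right_mono) auto
      with Suc.prems show "real m * h\<^sup>2 \<le> 1" by linarith
    qed simp
    finally show ?thesis by (simp add: E_def)
  qed
  let ?x = "\<lambda>\<omega> k. X k \<omega>"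
  have "(\<integral>\<omega>. exp (h\<^sup>2 / 2 * V (?x \<omega>) (Suc m)) * cos (h * path_sum f (?x \<omega>) (Suc m) + b) \<partial>M)
     = (\<integral>\<omega>. (E (?x \<omega>) * e (X m \<omega>) * cos (Y (?x \<omega>))) * cos (h * f (X m \<omega>) (X (Suc m) \<omega>))
        - (E (?x \<omega>) * e (X m \<omega>) * sin (Y (?x \<omega>))) * sin (h * f (X m \<omega>) (X (Suc m) \<omega>)) \<partial>M)"
  proof (rule Bochner_Integration.integral_cong[OF refl])
    fix \<omega>
    have "h * path_sum f (?x \<omega>) (Suc m) + b = Y (?x \<omega>) + h * f (X m \<omega>) (X (Suc m) \<omega>)"
      by (simp add: Y_def algebra_simps)
    moreover have "exp (h\<^sup>2 / 2 * V (?x \<omega>) (Suc m)) = E (?x \<omega>) * e (X m \<omega>)"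
      by (simp add: E_def e_def V_def exp_add[symmetric] algebra_simps)
    ultimately show "exp (h\<^sup>2 / 2 * V (?x \<omega>) (Suc m)) * cos (h * path_sum f (?x \<omega>) (Suc m) + b)
      = (E (?x \<omega>) * e (X m \<omega>) * cos (Y (?x \<omega>))) * cos (h * f (X m \<omega>) (X (Suc m) \<omega>))
        - (E (?x \<omega>) * e (X m \<omega>) * sin (Y (?x \<omega>))) * sin (h * f (X m \<omega>) (X (Suc m) \<omega>))"
      by (simp only: cos_add) (simp add: algebra_simps)
  qed
  also have "\<dots> = (\<integral>\<omega>. (E (?x \<omega>) * e (X m \<omega>) * cos (Y (?x \<omega>))) * cos (h * f (X m \<omega>) (X (Suc m) \<omega>)) \<partial>M)
        - (\<integral>\<omega>. (E (?x \<omega>) * e (X m \<omega>) * sin (Y (?x \<omega>))) * sin (h * f (X m \<omega>) (X (Suc m) \<omega>)) \<partial>M)"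
    by (intro Bochner_Integration.integral_diff
        int[of "\<lambda>x. (E x * e (x m) * cos (Y x)) * cos (h * f (x m) (x (Suc m)))"]
        int[of "\<lambda>x. (E x * e (x m) * sin (Y x)) * sin (h * f (x m) (x (Suc m)))"]) (simp_all add: dep')
  also have "(\<integral>\<omega>. (E (?x \<omega>) * e (X m \<omega>) * cos (Y (?x \<omega>))) * cos (h * f (X m \<omega>) (X (Suc m) \<omega>)) \<partial>M)
     = (\<integral>\<omega>. (E (?x \<omega>) * e (X m \<omega>) * cos (Y (?x \<omega>))) * c (X m \<omega>) \<partial>M)"
    unfolding c_def
    by (rule integral_one_step[OF mc, where G = "\<lambda>x. E x * e (x m) * cos (Y x)" and g = "\<lambda>i j. cos (h * f i j)"])
      (simp add: dep)
  also have "(\<integral>\<omega>. (E (?x \<omega>) * e (X m \<omega>) * sin (Y (?x \<omega>))) * sin (h * f (X m \<omega>) (X (Suc m) \<omega>)) \<partial>M)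
     = (\<integral>\<omega>. (E (?x \<omega>) * e (X m \<omega>) * sin (Y (?x \<omega>))) * s (X m \<omega>) \<partial>M)"
    unfolding s_def
    by (rule integral_one_step[OF mc, where G = "\<lambda>x. E x * e (x m) * sin (Y x)" and g = "\<lambda>i j. sin (h * f i j)"])
      (simp add: dep)
  finally have step: "(\<integral>\<omega>. exp (h\<^sup>2 / 2 * V (?x \<omega>) (Suc m)) * cos (h * path_sum f (?x \<omega>) (Suc m) + b) \<partial>M)
     - (\<integral>\<omega>. E (?x \<omega>) * cos (Y (?x \<omega>)) \<partial>M)
     = (\<integral>\<omega>. (E (?x \<omega>) * e (X m \<omega>) * cos (Y (?x \<omega>))) * c (X m \<omega>) \<partial>M)
       - (\<integral>\<omega>. (E (?x \<omega>) * e (X m \<omega>) * sin (Y (?x \<omega>))) * s (X m \<omega>) \<partial>M)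
       - (\<integral>\<omega>. E (?x \<omega>) * cos (Y (?x \<omega>)) \<partial>M)" by simp
  also have "\<dots> = (\<integral>\<omega>. (E (?x \<omega>) * e (X m \<omega>) * cos (Y (?x \<omega>))) * c (X m \<omega>)
       - (E (?x \<omega>) * e (X m \<omega>) * sin (Y (?x \<omega>))) * s (X m \<omega>)
       - E (?x \<omega>) * cos (Y (?x \<omega>)) \<partial>M)"
    by (subst Bochner_Integration.integral_diff[symmetric],
        rule int[of "\<lambda>x. (E x * e (x m) * cos (Y x)) * c (x m)"], simp add: dep',
        rule int[of "\<lambda>x. (E x * e (x m) * sin (Y x)) * s (x m)"], simp add: dep',
        subst Bochner_Integration.integral_diff[symmetric],
        rule int[of "\<lambda>x. (E x * e (x m) * cos (Y x)) * c (x m) - (E x * e (x m) * sin (Y x)) * s (x m)"], simp add: dep',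
        rule int[of "\<lambda>x. E x * cos (Y x)"], simp add: dep', rule refl)
  also have "\<bar>\<dots>\<bar> \<le> exp (B\<^sup>2 / 2) * (2 * K)"
  proof -
    have pt: "\<bar>(E x * e i * cos y) * c i - (E x * e i * sin y) * s i - E x * cos y\<bar> \<le> exp (B\<^sup>2 / 2) * (2 * K)"
      for x i y
    proof -
      have 1: "\<bar>(e i * c i - 1) * cos y\<bar> \<le> K * 1"
        unfolding abs_mult e_def c_def K_def
        by (intro mult_mono compensated_step[OF P f0 B h] abs_cos_le_one) (use B0 h in auto)
      have 2: "\<bar>(e i * s i) * sin y\<bar> \<le> K * 1"
        unfolding abs_mult[of _ "sin y"] e_def s_def K_def
        by (intro mult_mono compensated_step[OF P f0 B h] abs_sin_le_one) (use B0 h in auto)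
      have "(E x * e i * cos y) * c i - (E x * e i * sin y) * s i - E x * cos y
         = E x * ((e i * c i - 1) * cos y - (e i * s i) * sin y)" by (simp add: algebra_simps)
      also have "\<bar>\<dots>\<bar> \<le> exp (B\<^sup>2 / 2) * (2 * K)"
        unfolding abs_mult[of "E x"] using E_le 1 2
        by (intro mult_mono) (auto simp: E_def)
      finally show ?thesis .
    qed
    have i: "integrable M (\<lambda>\<omega>. (E (?x \<omega>) * e (X m \<omega>) * cos (Y (?x \<omega>))) * c (X m \<omega>)
       - (E (?x \<omega>) * e (X m \<omega>) * sin (Y (?x \<omega>))) * s (X m \<omega>) - E (?x \<omega>) * cos (Y (?x \<omega>)))"
      by (rule int[of "\<lambda>x. (E x * e (x m) * cos (Y x)) * c (x m) - (E x * e (x m) * sin (Y x)) * s (x m) - E x * cos (Y x)"])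
        (simp add: dep')
    show ?thesis
      by (rule order_trans[OF integral_abs_bound integral_le_const[OF integrable_abs[OF i]]]) (simp add: pt)
  qed
  also have "exp (B\<^sup>2 / 2) * (2 * K) = 2 * exp (B\<^sup>2) * (B ^ 3 + B ^ 4) * h ^ 3"
  proof -
    have "exp (B\<^sup>2) = exp (B\<^sup>2 / 2) * exp (B\<^sup>2 / 2)" by (simp add: exp_add[symmetric])
    then show ?thesis by (simp add: K_def)
  qed
  finally have step': "\<bar>(\<integral>\<omega>. exp (h\<^sup>2 / 2 * V (?x \<omega>) (Suc m)) * cos (h * path_sum f (?x \<omega>) (Suc m) + b) \<partial>M)
     - (\<integral>\<omega>. E (?x \<omega>) * cos (Y (?x \<omega>)) \<partial>M)\<bar> \<le> 2 * exp (B\<^sup>2) * (B ^ 3 + B ^ 4) * h ^ 3" .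
  have "real m * h\<^sup>2 \<le> real (Suc m) * h\<^sup>2" by (intro mult_right_mono) auto
  with Suc.prems have "real m * h\<^sup>2 \<le> 1" by linarith
  from Suc.IH[OF this] have "\<bar>(\<integral>\<omega>. E (?x \<omega>) * cos (Y (?x \<omega>)) \<partial>M) - cos b\<bar>
      \<le> real m * (2 * exp (B\<^sup>2) * (B ^ 3 + B ^ 4) * h ^ 3)" by (simp only: E_def Y_def)
  moreover have "real (Suc m) * (2 * exp (B\<^sup>2) * (B ^ 3 + B ^ 4) * h ^ 3)
      = real m * (2 * exp (B\<^sup>2) * (B ^ 3 + B ^ 4) * h ^ 3) + 2 * exp (B\<^sup>2) * (B ^ 3 + B ^ 4) * h ^ 3"
    by (simp only: of_nat_Suc distrib_right mult_1_left add.commute)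
  ultimately show ?case using step' by linarith
qed

text \<open>With \<open>h = 1 / sqrt n\<close> the accumulated error after \<open>n\<close> steps is of order \<open>1 / sqrt n\<close>. The
  random compensator in the exponent converges to the constant \<open>v / 2\<close> and can then be moved out of
  the expectation.\<close>

theorem path_sum_clt_cos:
  fixes X :: "nat \<Rightarrow> 'a \<Rightarrow> 's::finite" and f :: "'s \<Rightarrow> 's \<Rightarrow> real"
  assumes P: "stochastic_mat P" and mc: "markov_chain M P X"
    and f0: "\<And>i. (\<Sum>j\<in>UNIV. P $ i $ j * f i j) = 0"
    and var: "AE \<omega> in M. (\<lambda>n. path_sum (\<lambda>i _. step_variance P f i) (\<lambda>k. X k \<omega>) n / real n) \<longlonglongrightarrow> v"
  shows "(\<lambda>n. \<integral>\<omega>. cos (path_sum f (\<lambda>k. X k \<omega>) n / sqrt (real n) + b) \<partial>M) \<longlonglongrightarrow> exp (- v / 2) * cos b"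
proof -
  interpret prob_space M by (rule markov_chain_prob_space[OF mc])
  define B where "B = (\<Sum>i\<in>UNIV. \<Sum>j\<in>UNIV. \<bar>f i j\<bar>)"
  have B: "\<bar>f i j\<bar> \<le> B" for i j unfolding B_def by (rule abs_le_double_sum_abs)
  let ?x = "\<lambda>\<omega> k. X k \<omega>"
  let ?V = "path_sum (\<lambda>i _. step_variance P f i)"
  let ?C = "2 * exp (B\<^sup>2) * (B ^ 3 + B ^ 4)"
  let ?E = "\<lambda>\<omega> n. exp (?V (?x \<omega>) n / real n / 2)"
  let ?c = "\<lambda>\<omega> n. cos (path_sum f (?x \<omega>) n / sqrt (real n) + b)"
  have V_le: "?V x n / real n \<le> B\<^sup>2" for x n
  proof (cases "n = 0")
    case False
    have "?V x n \<le> (\<Sum>k<n. B\<^sup>2)"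
      unfolding path_sum_def by (intro sum_mono step_variance_bounds[OF P B])
    with False show ?thesis by (simp add: field_simps)
  qed simp
  have int: "integrable M (\<lambda>\<omega>. ?E \<omega> n * ?c \<omega> n)" "integrable M (\<lambda>\<omega>. ?c \<omega> n)" for n
    by (rule integrable_path_function[OF mc, where m = n and
        G = "\<lambda>x. exp (?V x n / real n / 2) * cos (path_sum f x n / sqrt (real n) + b)"], simp add: path_sum_restrict,
      rule integrable_path_function[OF mc, where m = n and G = "\<lambda>x. cos (path_sum f x n / sqrt (real n) + b)"],
      simp add: path_sum_restrict)
  have "(\<lambda>n. (\<integral>\<omega>. ?E \<omega> n * ?c \<omega> n \<partial>M) - cos b) \<longlonglongrightarrow> 0"
  proof (rule Lim_null_comparison, rule eventually_sequentiallyI[of 1])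
    fix n :: nat assume n: "1 \<le> n"
    define h where "h = 1 / sqrt (real n)"
    have h: "0 \<le> h" "h \<le> 1" "real n * h\<^sup>2 \<le> 1" "h\<^sup>2 = 1 / real n"
      using n by (auto simp: h_def power_divide)
    have "\<bar>(\<integral>\<omega>. exp (h\<^sup>2 / 2 * ?V (?x \<omega>) n) * cos (h * path_sum f (?x \<omega>) n + b) \<partial>M) - cos b\<bar>
       \<le> real n * (?C * h ^ 3)"
      by (rule compensated_cos_near_constant[OF P mc f0 B h(1-3)])
    also have "real n * (?C * h ^ 3) = ?C * (real n * h\<^sup>2) * h" by (simp add: power3_eq_cube power2_eq_square)
    also have "\<dots> = ?C * h" using n by (simp add: h(4))
    finally show "norm ((\<integral>\<omega>. ?E \<omega> n * ?c \<omega> n \<partial>M) - cos b) \<le> ?C * (1 / sqrt (real n))"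
      by (simp add: h(4)) (simp add: h_def)
  next
    have "(\<lambda>n. ?C * (1 / sqrt (real n))) \<longlonglongrightarrow> ?C * 0"
      by (intro tendsto_mult tendsto_const tendsto_divide_0[OF tendsto_const]
          filterlim_at_top_imp_at_infinity filterlim_compose[OF sqrt_at_top filterlim_real_sequentially])
    then show "(\<lambda>n. ?C * (1 / sqrt (real n))) \<longlonglongrightarrow> 0" by simp
  qed
  then have 1: "(\<lambda>n. (\<integral>\<omega>. ?E \<omega> n * ?c \<omega> n \<partial>M)) \<longlonglongrightarrow> cos b" by (simp add: LIM_zero_iff)
  have "(\<lambda>n. (\<integral>\<omega>. (?E \<omega> n - exp (v / 2)) * ?c \<omega> n \<partial>M)) \<longlonglongrightarrow> (\<integral>\<omega>. 0 \<partial>M)"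
  proof (rule integral_dominated_convergence[where w = "\<lambda>_. exp (B\<^sup>2 / 2) + exp (v / 2)"])
    show "(\<lambda>\<omega>. (?E \<omega> n - exp (v / 2)) * ?c \<omega> n) \<in> borel_measurable M" for n
      using int[of n] by (auto simp: left_diff_distrib)
    show "AE \<omega> in M. (\<lambda>n. (?E \<omega> n - exp (v / 2)) * ?c \<omega> n) \<longlonglongrightarrow> 0"
      using var
    proof eventually_elim
      case (elim \<omega>)
      have "(\<lambda>n. ?E \<omega> n - exp (v / 2)) \<longlonglongrightarrow> exp (v / 2) - exp (v / 2)"
        by (intro tendsto_intros elim) simp
      then have "(\<lambda>n. ?E \<omega> n - exp (v / 2)) \<longlonglongrightarrow> 0" by simp
      then show ?case
      proof (rule tendsto_0_le[where K = 1], intro always_eventually allI)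
        fix n
        have "\<bar>?E \<omega> n - exp (v / 2)\<bar> * \<bar>?c \<omega> n\<bar> \<le> \<bar>?E \<omega> n - exp (v / 2)\<bar> * 1"
          by (intro mult_left_mono abs_cos_le_one) simp
        then show "norm ((?E \<omega> n - exp (v / 2)) * ?c \<omega> n) \<le> norm (?E \<omega> n - exp (v / 2)) * 1"
          by (simp add: abs_mult)
      qed
    qed
    show "AE \<omega> in M. norm ((?E \<omega> n - exp (v / 2)) * ?c \<omega> n) \<le> exp (B\<^sup>2 / 2) + exp (v / 2)" for n
    proof (rule AE_I2)
      fix \<omega>
      have "?E \<omega> n \<le> exp (B\<^sup>2 / 2)" using V_le[of "?x \<omega>" n] by simp
      then have "\<bar>?E \<omega> n - exp (v / 2)\<bar> \<le> exp (B\<^sup>2 / 2) + exp (v / 2)"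
        using exp_gt_zero[of "v / 2"] exp_gt_zero[of "?V (?x \<omega>) n / real n / 2"] by linarith
      then have "\<bar>?E \<omega> n - exp (v / 2)\<bar> * \<bar>?c \<omega> n\<bar> \<le> (exp (B\<^sup>2 / 2) + exp (v / 2)) * 1"
        by (intro mult_mono abs_cos_le_one) auto
      then show "norm ((?E \<omega> n - exp (v / 2)) * ?c \<omega> n) \<le> exp (B\<^sup>2 / 2) + exp (v / 2)"
        by (simp add: abs_mult)
    qed
  qed auto
  then have "(\<lambda>n. (\<integral>\<omega>. ?E \<omega> n * ?c \<omega> n \<partial>M) - exp (v / 2) * (\<integral>\<omega>. ?c \<omega> n \<partial>M)) \<longlonglongrightarrow> 0"
    using int by (simp add: left_diff_distrib)
  from tendsto_diff[OF 1 this] have "(\<lambda>n. exp (v / 2) * (\<integral>\<omega>. ?c \<omega> n \<partial>M)) \<longlonglongrightarrow> cos b" by simp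
  then have "(\<lambda>n. exp (- v / 2) * (exp (v / 2) * (\<integral>\<omega>. ?c \<omega> n \<partial>M))) \<longlonglongrightarrow> exp (- v / 2) * cos b"
    by (intro tendsto_mult tendsto_const)
  moreover have "exp (- v / 2) * (exp (v / 2) * r) = r" for r
    by (simp only: mult.assoc[symmetric] exp_add[symmetric]) simp
  ultimately show ?thesis by (simp only:)
qed

section \<open>Convergence in distribution from trigonometric polynomials\<close>

text \<open>Trigonometric polynomials; a phase makes sines and constants special cases of cosines, and
  products reduce to sums by the addition formulas.\<close>

inductive trig_poly :: "('b::euclidean_space \<Rightarrow> real) \<Rightarrow> bool" where
  wave: "trig_poly (\<lambda>x. cos (t \<bullet> x + b))"
| scale: "trig_poly g \<Longrightarrow> trig_poly (\<lambda>x. c * g x)"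
| add: "trig_poly g \<Longrightarrow> trig_poly h \<Longrightarrow> trig_poly (\<lambda>x. g x + h x)"

lemma trig_poly_const: "trig_poly (\<lambda>x. c)"
  using trig_poly.scale[OF trig_poly.wave[of 0 0], of c] by simp

lemma trig_poly_wave_mult:
  assumes "trig_poly g"
  shows "trig_poly (\<lambda>x. cos (t \<bullet> x + b) * g x)"
  using assms
proof (induction rule: trig_poly.induct)
  case (wave t' b')
  have "(\<lambda>x. cos (t \<bullet> x + b) * cos (t' \<bullet> x + b'))
      = (\<lambda>x. 1/2 * cos ((t - t') \<bullet> x + (b - b')) + 1/2 * cos ((t + t') \<bullet> x + (b + b')))"
    by (simp add: cos_times_cos inner_add_left inner_diff_left add_divide_distrib algebra_simps)
  then show ?case by (simp only:) (intro trig_poly.intros)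
next
  case (scale g c)
  then show ?case using trig_poly.scale[of "\<lambda>x. cos (t \<bullet> x + b) * g x" c] by (simp add: ac_simps)
next
  case (add g h)
  then show ?case using trig_poly.add by (simp add: distrib_left)
qed

lemma trig_poly_mult:
  assumes "trig_poly g" "trig_poly h"
  shows "trig_poly (\<lambda>x. g x * h x)"
  using assms(1)
proof (induction rule: trig_poly.induct)
  case (wave t b)
  show ?case by (rule trig_poly_wave_mult[OF assms(2)])
next
  case (scale g c)
  then show ?case using trig_poly.scale[of "\<lambda>x. g x * h x" c] by (simp add: ac_simps)
next
  case (add g1 g2)
  then show ?case using trig_poly.add by (simp add: distrib_right)
qed

lemma trig_poly_sum:
  assumes "finite I" "\<And>i. i \<in> I \<Longrightarrow> trig_poly (g i)"
  shows "trig_poly (\<lambda>x. \<Sum>i\<in>I. g i x)"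
  using assms by (induction) (auto intro: trig_poly_const trig_poly.add)

lemma trig_poly_sin: "trig_poly (\<lambda>x. sin (t \<bullet> x))"
proof -
  have "(\<lambda>x. sin (t \<bullet> x)) = (\<lambda>x. cos (t \<bullet> x + (- pi / 2)))"
    by (simp add: fun_eq_iff cos_diff)
  then show ?thesis by (simp only: trig_poly.wave)
qed

lemma trig_poly_continuous: "trig_poly g \<Longrightarrow> continuous_on UNIV g"
  by (induction rule: trig_poly.induct) (auto intro!: continuous_intros)

lemma trig_poly_bounded: "trig_poly g \<Longrightarrow> \<exists>C. \<forall>x. \<bar>g x\<bar> \<le> C"
proof (induction rule: trig_poly.induct)
  case (wave t b)
  show ?case by (rule exI[of _ 1]) simp
next
  case (scale g c)
  then obtain C where "\<And>x. \<bar>g x\<bar> \<le> C" by blast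
  then have "\<bar>c * g x\<bar> \<le> \<bar>c\<bar> * C" for x by (simp add: abs_mult mult_left_mono)
  then show ?case by blast
next
  case (add g h)
  then obtain C D where "\<And>x. \<bar>g x\<bar> \<le> C" "\<And>x. \<bar>h x\<bar> \<le> D" by blast
  then have "\<bar>g x + h x\<bar> \<le> C + D" for x by (meson abs_triangle_ineq add_mono order_trans)
  then show ?case by blast
qed

lemma trig_poly_of_polynomial:
  assumes "real_polynomial_function g"
  shows "trig_poly (\<lambda>x. g (\<Sum>b\<in>Basis. sin (x \<bullet> b / K) *\<^sub>R b))"
  using assms
proof (induction rule: real_polynomial_function.induct)
  case (linear g)
  have "g (\<Sum>b\<in>Basis. sin (x \<bullet> b / K) *\<^sub>R b) = (\<Sum>b\<in>Basis. g b * sin ((b /\<^sub>R K) \<bullet> x))" for x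
    using linear by (simp add: linear_sum linear_scale bounded_linear.linear inner_commute divide_inverse mult.commute)
  then show ?case
    by (simp only:) (intro trig_poly_sum trig_poly.scale trig_poly_sin finite_Basis)
next
  case (const c)
  show ?case by (rule trig_poly_const)
next
  case (add g h)
  then show ?case by (intro trig_poly.add)
next
  case (mult g h)
  then show ?case by (intro trig_poly_mult)
qed

text \<open>The function \<open>K arcsin (sin (z / K))\<close> is the identity on \<open>[- K \<pi> / 2, K \<pi> / 2]\<close>. Composing
  \<open>f\<close> with it in each coordinate gives a function that agrees with \<open>f\<close> on a large ball, has the
  same bound everywhere, and factors through the map \<open>x \<mapsto> (sin (x\<^sub>b / K))\<^sub>b\<close> into a compact cube,
  where Stone and Weierstrass provide an approximating polynomial.\<close>

lemma trig_poly_approximation: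
  fixes f :: "'b::euclidean_space \<Rightarrow> real"
  assumes f: "continuous_on UNIV f" and C: "\<And>x. \<bar>f x\<bar> \<le> C" and e: "0 < e"
  obtains g where "trig_poly g" "\<And>x. \<bar>f x - g x\<bar> \<le> e + 2 * C * indicator {x. R < norm x} x"
proof -
  define K where "K = max R 1"
  have K: "0 < K" "R \<le> K" by (auto simp: K_def)
  define F where "F y = f (\<Sum>b\<in>Basis. (K * arcsin (y \<bullet> b)) *\<^sub>R b)" for y :: 'b
  define y where "y x = (\<Sum>b\<in>Basis. sin (x \<bullet> b / K) *\<^sub>R b)" for x :: 'b
  let ?S = "cbox (- One) One :: 'b set"
  have "continuous_on ?S F"
    unfolding F_def
    by (intro continuous_on_compose2[OF f] continuous_intros) (auto simp: mem_box)
  then obtain g where g: "real_polynomial_function g" "\<And>z. z \<in> ?S \<Longrightarrow> \<bar>F z - g z\<bar> < e"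
    using Stone_Weierstrass_real_polynomial_function[OF compact_cbox _ e] by blast
  have y_in: "y x \<in> ?S" for x by (simp add: mem_box y_def)
  have "trig_poly (\<lambda>x. g (y x))"
    unfolding y_def by (rule trig_poly_of_polynomial[OF g(1)])
  moreover have "\<bar>f x - g (y x)\<bar> \<le> e + 2 * C * indicator {x. R < norm x} x" for x
  proof (cases "R < norm x")
    case True
    have "\<bar>F (y x)\<bar> \<le> C" by (simp add: F_def C)
    with True g(2)[OF y_in, of x] C[of x] show ?thesis by simp
  next
    case False
    have "arcsin (y x \<bullet> b) = x \<bullet> b / K" if "b \<in> Basis" for b
    proof -
      have "\<bar>x \<bullet> b\<bar> \<le> K" using False K Basis_le_norm[OF that, of x] by linarith
      then have "\<bar>x \<bullet> b / K\<bar> \<le> 1" using K by (simp add: abs_divide)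
      moreover have "1 \<le> pi / 2" using pi_ge_two by simp
      ultimately have "\<bar>x \<bullet> b / K\<bar> \<le> pi / 2" by linarith
      then have "arcsin (sin (x \<bullet> b / K)) = x \<bullet> b / K" by (intro arcsin_sin) linarith+
      then show ?thesis using that by (simp add: y_def)
    qed
    then have "F (y x) = f (\<Sum>b\<in>Basis. (x \<bullet> b) *\<^sub>R b)" using K by (simp add: F_def)
    also have "\<dots> = f x" by (simp add: euclidean_representation)
    finally show ?thesis using False g(2)[OF y_in, of x] by simp
  qed
  ultimately show thesis by (rule that)
qed

definition tight_seq :: "'a measure \<Rightarrow> (nat \<Rightarrow> 'a \<Rightarrow> 'b::real_normed_vector) \<Rightarrow> bool" where
  "tight_seq M Y \<longleftrightarrow>
     (\<forall>e>0. \<exists>R. eventually (\<lambda>n. measure M {\<omega> \<in> space M. R < norm (Y n \<omega>)} \<le> e) sequentially)"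

lemma (in prob_space) prob_tendsto_0:
  assumes meas: "\<And>n. {\<omega> \<in> space M. Q n \<omega>} \<in> sets M"
    and ev: "AE \<omega> in M. eventually (\<lambda>n. \<not> Q n \<omega>) sequentially"
  shows "(\<lambda>n. prob {\<omega> \<in> space M. Q n \<omega>}) \<longlonglongrightarrow> 0"
proof -
  have "(\<lambda>n. \<integral>\<omega>. indicator {\<omega> \<in> space M. Q n \<omega>} \<omega> \<partial>M) \<longlonglongrightarrow> (\<integral>\<omega>. (0::real) \<partial>M)"
  proof (rule integral_dominated_convergence[where w = "\<lambda>_. 1"])
    show "AE \<omega> in M. (\<lambda>n. indicator {\<omega> \<in> space M. Q n \<omega>} \<omega> :: real) \<longlonglongrightarrow> 0"
      using ev
    proof eventually_elim
      case (elim \<omega>)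
      then have "eventually (\<lambda>n. indicator {\<omega> \<in> space M. Q n \<omega>} \<omega> = (0::real)) sequentially"
        by eventually_elim simp
      then show ?case by (rule tendsto_eventually)
    qed
  qed (use meas in \<open>auto simp: indicator_def\<close>)
  then show ?thesis using meas by simp
qed

lemma (in prob_space) prob_norm_large:
  fixes Z :: "'a \<Rightarrow> 'b::euclidean_space"
  assumes [measurable]: "Z \<in> borel_measurable M" and e: "0 < e"
  obtains R where "prob {\<omega> \<in> space M. R < norm (Z \<omega>)} \<le> e"
proof -
  have "(\<lambda>n. prob {\<omega> \<in> space M. real n < norm (Z \<omega>)}) \<longlonglongrightarrow> 0"
  proof (rule prob_tendsto_0)
    show "AE \<omega> in M. eventually (\<lambda>n. \<not> real n < norm (Z \<omega>)) sequentially"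
    proof (rule AE_I2)
      fix \<omega>
      obtain m :: nat where "norm (Z \<omega>) \<le> real m" using real_arch_simple by blast
      then show "eventually (\<lambda>n. \<not> real n < norm (Z \<omega>)) sequentially"
        by (intro eventually_sequentiallyI[of m]) simp
    qed
  qed simp
  from order_tendstoD(2)[OF this e] obtain n where "prob {\<omega> \<in> space M. real n < norm (Z \<omega>)} < e"
    by (auto simp: eventually_sequentially)
  then show thesis by (intro that[of "real n"]) simp
qed

lemma tight_seq_close:
  fixes Y Y' :: "nat \<Rightarrow> 'a \<Rightarrow> 'b::euclidean_space"
  assumes M: "prob_space M" and [measurable]: "\<And>n. Y n \<in> borel_measurable M" "\<And>n. Y' n \<in> borel_measurable M"
    and close: "AE \<omega> in M. (\<lambda>n. Y n \<omega> - Y' n \<omega>) \<longlonglongrightarrow> 0" and tight: "tight_seq M Y'"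
  shows "tight_seq M Y"
  unfolding tight_seq_def
proof (intro allI impI)
  interpret prob_space M by (rule M)
  fix e :: real assume "0 < e"
  then have e2: "0 < e / 2" by simp
  then obtain R where R: "eventually (\<lambda>n. prob {\<omega> \<in> space M. R < norm (Y' n \<omega>)} \<le> e / 2) sequentially"
    using tight unfolding tight_seq_def by blast
  have "(\<lambda>n. prob {\<omega> \<in> space M. 1 < norm (Y n \<omega> - Y' n \<omega>)}) \<longlonglongrightarrow> 0"
  proof (rule prob_tendsto_0)
    show "AE \<omega> in M. eventually (\<lambda>n. \<not> 1 < norm (Y n \<omega> - Y' n \<omega>)) sequentially"
      using close
    proof eventually_elim
      case (elim \<omega>)
      then have "(\<lambda>n. norm (Y n \<omega> - Y' n \<omega>)) \<longlonglongrightarrow> 0" by (simp add: tendsto_norm_zero_iff)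
      from order_tendstoD(2)[OF this zero_less_one] show ?case by eventually_elim simp
    qed
  qed simp
  from R order_tendstoD(2)[OF this e2]
  have "eventually (\<lambda>n. prob {\<omega> \<in> space M. R + 1 < norm (Y n \<omega>)} \<le> e) sequentially"
  proof eventually_elim
    case (elim n)
    have "norm (Y n \<omega>) \<le> norm (Y' n \<omega>) + norm (Y n \<omega> - Y' n \<omega>)" for \<omega>
      using norm_triangle_sub[of "Y n \<omega>" "Y' n \<omega>"] .
    then have "{\<omega> \<in> space M. R + 1 < norm (Y n \<omega>)}
      \<subseteq> {\<omega> \<in> space M. R < norm (Y' n \<omega>)} \<union> {\<omega> \<in> space M. 1 < norm (Y n \<omega> - Y' n \<omega>)}"
      by (smt (verit, best) Un_iff mem_Collect_eq subsetI)
    then have "prob {\<omega> \<in> space M. R + 1 < norm (Y n \<omega>)}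
      \<le> prob ({\<omega> \<in> space M. R < norm (Y' n \<omega>)} \<union> {\<omega> \<in> space M. 1 < norm (Y n \<omega> - Y' n \<omega>)})"
      by (rule finite_measure_mono) measurable
    also have "\<dots> \<le> prob {\<omega> \<in> space M. R < norm (Y' n \<omega>)} + prob {\<omega> \<in> space M. 1 < norm (Y n \<omega> - Y' n \<omega>)}"
      by (rule measure_Un_le) measurable
    finally show ?case using elim by simp
  qed
  then show "\<exists>R. eventually (\<lambda>n. prob {\<omega> \<in> space M. R < norm (Y n \<omega>)} \<le> e) sequentially" by blast
qed

text \<open>Chebyshev's inequality with one bound for all large \<open>n\<close>.\<close>

lemma tight_seq_second_moment:
  fixes Y :: "nat \<Rightarrow> 'a \<Rightarrow> 'b::euclidean_space"
  assumes M: "prob_space M" and [measurable]: "\<And>n. Y n \<in> borel_measurable M"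
    and int: "\<And>n. integrable M (\<lambda>\<omega>. (norm (Y n \<omega>))\<^sup>2)"
    and c: "eventually (\<lambda>n. (\<integral>\<omega>. (norm (Y n \<omega>))\<^sup>2 \<partial>M) \<le> c) sequentially"
  shows "tight_seq M Y"
  unfolding tight_seq_def
proof (intro allI impI)
  interpret prob_space M by (rule M)
  fix e :: real assume e: "0 < e"
  define R where "R = sqrt ((\<bar>c\<bar> + 1) / e)"
  have R: "0 < R" "R\<^sup>2 * e = \<bar>c\<bar> + 1" using e by (auto simp: R_def)
  show "\<exists>R. eventually (\<lambda>n. prob {\<omega> \<in> space M. R < norm (Y n \<omega>)} \<le> e) sequentially"
    using c
  proof (intro exI[of _ R], elim eventually_mono)
    fix n assume elim: "(\<integral>\<omega>. (norm (Y n \<omega>))\<^sup>2 \<partial>M) \<le> c"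
    have "R\<^sup>2 * prob {\<omega> \<in> space M. R < norm (Y n \<omega>)}
       = (\<integral>\<omega>. R\<^sup>2 * indicator {\<omega> \<in> space M. R < norm (Y n \<omega>)} \<omega> \<partial>M)" by simp
    also have "\<dots> \<le> (\<integral>\<omega>. (norm (Y n \<omega>))\<^sup>2 \<partial>M)"
    proof (intro integral_mono int)
      show "integrable M (\<lambda>\<omega>. R\<^sup>2 * indicator {\<omega> \<in> space M. R < norm (Y n \<omega>)} \<omega>)"
        by (intro integrable_mult_right integrable_real_indicator) (auto simp: emeasure_eq_measure)
      fix \<omega>
      show "R\<^sup>2 * indicator {\<omega> \<in> space M. R < norm (Y n \<omega>)} \<omega> \<le> (norm (Y n \<omega>))\<^sup>2"
        using R(1) by (auto simp: indicator_def intro!: power_mono)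
    qed
    also have "\<dots> \<le> R\<^sup>2 * e" using elim R(2) by linarith
    finally show "prob {\<omega> \<in> space M. R < norm (Y n \<omega>)} \<le> e" using R(1) by simp
  qed
qed

lemma (in prob_space) integral_approx:
  fixes Y :: "'a \<Rightarrow> 'b::euclidean_space" and f g :: "'b \<Rightarrow> real"
  assumes [measurable]: "Y \<in> borel_measurable M" "f \<in> borel_measurable borel" "g \<in> borel_measurable borel"
    and C: "\<And>x. \<bar>f x\<bar> \<le> C" and D: "\<And>x. \<bar>g x\<bar> \<le> D"
    and approx: "\<And>x. \<bar>f x - g x\<bar> \<le> e + 2 * C * indicator {x. R < norm x} x"
  shows "\<bar>(\<integral>\<omega>. f (Y \<omega>) \<partial>M) - (\<integral>\<omega>. g (Y \<omega>) \<partial>M)\<bar> \<le> e + 2 * C * prob {\<omega> \<in> space M. R < norm (Y \<omega>)}"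
proof -
  have i1: "integrable M (\<lambda>\<omega>. f (Y \<omega>))" by (rule integrable_const_bound[where B = C]) (auto simp: C)
  have i2: "integrable M (\<lambda>\<omega>. g (Y \<omega>))" by (rule integrable_const_bound[where B = D]) (auto simp: D)
  have ind: "integrable M (\<lambda>\<omega>. 2 * C * indicator {\<omega> \<in> space M. R < norm (Y \<omega>)} \<omega>)"
    by (intro integrable_mult_right integrable_real_indicator) (auto simp: emeasure_eq_measure)
  have "\<bar>(\<integral>\<omega>. f (Y \<omega>) \<partial>M) - (\<integral>\<omega>. g (Y \<omega>) \<partial>M)\<bar> = \<bar>\<integral>\<omega>. f (Y \<omega>) - g (Y \<omega>) \<partial>M\<bar>"
    using i1 i2 by simp
  also have "\<dots> \<le> (\<integral>\<omega>. \<bar>f (Y \<omega>) - g (Y \<omega>)\<bar> \<partial>M)" by (rule integral_abs_bound)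
  also have "\<dots> \<le> (\<integral>\<omega>. e + 2 * C * indicator {\<omega> \<in> space M. R < norm (Y \<omega>)} \<omega> \<partial>M)"
    using i1 i2 ind approx[of "Y _"] by (intro integral_mono) (auto simp: indicator_def)
  also have "\<dots> = e + 2 * C * prob {\<omega> \<in> space M. R < norm (Y \<omega>)}"
    using ind by (subst Bochner_Integration.integral_add) (auto simp: prob_space)
  finally show ?thesis .
qed

text \<open>Tightness confines all laws to one large ball up to a small mass, and inside the ball a bounded
  continuous function may be replaced by a trigonometric polynomial, whose expectations converge by
  linearity.\<close>

theorem cramer_wold:
  fixes Y :: "nat \<Rightarrow> 'a \<Rightarrow> 'b::euclidean_space" and Z :: "'c \<Rightarrow> 'b"
  assumes M: "prob_space M" and N: "prob_space N"
    and Y [measurable]: "\<And>n. Y n \<in> borel_measurable M" and Z [measurable]: "Z \<in> borel_measurable N"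
    and waves: "\<And>t b. (\<lambda>n. \<integral>\<omega>. cos (t \<bullet> Y n \<omega> + b) \<partial>M) \<longlonglongrightarrow> (\<integral>\<omega>. cos (t \<bullet> Z \<omega> + b) \<partial>N)"
    and tight: "tight_seq M Y"
  shows "conv_in_distr M Y N Z"
proof -
  interpret M: prob_space M by (rule M)
  interpret N: prob_space N by (rule N)
  have trig_int: "integrable M (\<lambda>\<omega>. g (Y n \<omega>))" "integrable N (\<lambda>\<omega>. g (Z \<omega>))" if g: "trig_poly g" for g n
  proof -
    obtain C where C: "\<And>x. \<bar>g x\<bar> \<le> C" using trig_poly_bounded[OF g] by blast
    have [measurable]: "g \<in> borel_measurable borel"
      by (rule borel_measurable_continuous_onI[OF trig_poly_continuous[OF g]])
    show "integrable M (\<lambda>\<omega>. g (Y n \<omega>))" by (rule M.integrable_const_bound[where B = C]) (auto simp: C)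
    show "integrable N (\<lambda>\<omega>. g (Z \<omega>))" by (rule N.integrable_const_bound[where B = C]) (auto simp: C)
  qed
  have trig: "(\<lambda>n. \<integral>\<omega>. g (Y n \<omega>) \<partial>M) \<longlonglongrightarrow> (\<integral>\<omega>. g (Z \<omega>) \<partial>N)" if "trig_poly g" for g
    using that
  proof (induction rule: trig_poly.induct)
    case (wave t b)
    show ?case by (rule waves)
  next
    case (scale g c)
    then show ?case by (simp add: tendsto_mult_left)
  next
    case (add g h)
    then show ?case using trig_int by (simp add: tendsto_add)
  qed
  have "(\<lambda>n. \<integral>\<omega>. f (Y n \<omega>) \<partial>M) \<longlonglongrightarrow> (\<integral>\<omega>. f (Z \<omega>) \<partial>N)"
    if f: "continuous_on UNIV f" "bounded (range f)" for f :: "'b \<Rightarrow> real"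
  proof (rule tendstoI)
    fix e :: real assume e: "0 < e"
    obtain C where C: "\<And>x. \<bar>f x\<bar> \<le> C" using f(2) by (auto simp: bounded_iff)
    have C0: "0 \<le> C" using C abs_ge_zero order_trans by blast
    define d where "d = e / (5 + 4 * C)"
    have d0: "0 < d" using e C0 by (simp add: d_def)
    have "d * (5 + 4 * C) = e" using C0 by (simp add: d_def)
    then have d: "0 < d" "2 * (d + 2 * C * d) + d < e"
      using d0 by (auto simp: algebra_simps)
    obtain R1 where R1: "eventually (\<lambda>n. M.prob {\<omega> \<in> space M. R1 < norm (Y n \<omega>)} \<le> d) sequentially"
      using tight d(1) by (auto simp: tight_seq_def)
    obtain R2 where R2: "N.prob {\<omega> \<in> space N. R2 < norm (Z \<omega>)} \<le> d"
      using N.prob_norm_large[OF Z d(1)] by blast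
    define R where "R = max R1 R2"
    obtain g where g: "trig_poly g" "\<And>x. \<bar>f x - g x\<bar> \<le> d + 2 * C * indicator {x. R < norm x} x"
      using trig_poly_approximation[OF f(1) C d(1), of R] by blast
    obtain D where D: "\<And>x. \<bar>g x\<bar> \<le> D" using trig_poly_bounded[OF g(1)] by blast
    have fm: "f \<in> borel_measurable borel" and gm: "g \<in> borel_measurable borel"
      by (intro borel_measurable_continuous_onI f(1) trig_poly_continuous[OF g(1)])+
    have "N.prob {\<omega> \<in> space N. R < norm (Z \<omega>)} \<le> N.prob {\<omega> \<in> space N. R2 < norm (Z \<omega>)}"
      by (rule N.finite_measure_mono) (auto simp: R_def)
    then have "2 * C * N.prob {\<omega> \<in> space N. R < norm (Z \<omega>)} \<le> 2 * C * d"
      using R2 C0 by (intro mult_left_mono) auto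
    with N.integral_approx[OF Z fm gm C D g(2)]
    have Zd: "\<bar>(\<integral>\<omega>. f (Z \<omega>) \<partial>N) - (\<integral>\<omega>. g (Z \<omega>) \<partial>N)\<bar> \<le> d + 2 * C * d" by linarith
    show "eventually (\<lambda>n. dist (\<integral>\<omega>. f (Y n \<omega>) \<partial>M) (\<integral>\<omega>. f (Z \<omega>) \<partial>N) < e) sequentially"
      using R1 tendstoD[OF trig[OF g(1)] d(1)]
    proof eventually_elim
      case (elim n)
      have "M.prob {\<omega> \<in> space M. R < norm (Y n \<omega>)} \<le> M.prob {\<omega> \<in> space M. R1 < norm (Y n \<omega>)}"
        by (rule M.finite_measure_mono) (auto simp: R_def)
      then have "2 * C * M.prob {\<omega> \<in> space M. R < norm (Y n \<omega>)} \<le> 2 * C * d"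
        using elim C0 by (intro mult_left_mono) auto
      with M.integral_approx[OF Y[of n] fm gm C D g(2)]
      have "\<bar>(\<integral>\<omega>. f (Y n \<omega>) \<partial>M) - (\<integral>\<omega>. g (Y n \<omega>) \<partial>M)\<bar> \<le> d + 2 * C * d" by linarith
      moreover have "\<bar>y - z\<bar> < e" if "\<bar>z - z'\<bar> \<le> q" "\<bar>y' - z'\<bar> < d" "2 * q + d < e" "\<bar>y - y'\<bar> \<le> q"
        for y y' z z' q :: real
        using that by linarith
      ultimately show ?case using Zd elim(2) d(2) unfolding dist_real_def by blast
    qed
  qed
  then show ?thesis by (simp add: conv_in_distr_def)
qed

text \<open>Cosines are bounded and Lipschitz, so dominated convergence carries the limit over.\<close>

lemma waves_close:
  fixes Y Y' :: "nat \<Rightarrow> 'a \<Rightarrow> 'b::euclidean_space"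
  assumes M: "prob_space M" and [measurable]: "\<And>n. Y n \<in> borel_measurable M" "\<And>n. Y' n \<in> borel_measurable M"
    and close: "AE \<omega> in M. (\<lambda>n. Y n \<omega> - Y' n \<omega>) \<longlonglongrightarrow> 0"
    and lim: "(\<lambda>n. \<integral>\<omega>. cos (t \<bullet> Y' n \<omega> + b) \<partial>M) \<longlonglongrightarrow> l"
  shows "(\<lambda>n. \<integral>\<omega>. cos (t \<bullet> Y n \<omega> + b) \<partial>M) \<longlonglongrightarrow> l"
proof -
  interpret prob_space M by (rule M)
  have int: "integrable M (\<lambda>\<omega>. cos (t \<bullet> Y n \<omega> + b))" "integrable M (\<lambda>\<omega>. cos (t \<bullet> Y' n \<omega> + b))" for n
    by (rule integrable_const_bound[where B = 1]; simp)+
  have "(\<lambda>n. \<integral>\<omega>. cos (t \<bullet> Y n \<omega> + b) - cos (t \<bullet> Y' n \<omega> + b) \<partial>M) \<longlonglongrightarrow> (\<integral>\<omega>. 0 \<partial>M)"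
  proof (rule integral_dominated_convergence[where w = "\<lambda>_. 2"])
    show "AE \<omega> in M. (\<lambda>n. cos (t \<bullet> Y n \<omega> + b) - cos (t \<bullet> Y' n \<omega> + b)) \<longlonglongrightarrow> 0"
      using close
    proof eventually_elim
      case (elim \<omega>)
      show ?case
      proof (rule tendsto_0_le[OF elim, where K = "norm t"], intro always_eventually allI)
        fix n
        have lip: "\<bar>cos u - cos v\<bar> \<le> \<bar>u - v\<bar>" for u v :: real
        proof -
          have "\<bar>cos u - cos v\<bar> = 2 * \<bar>sin ((u + v) / 2)\<bar> * \<bar>sin ((v - u) / 2)\<bar>"
            by (simp add: cos_diff_cos abs_mult)
          also have "\<dots> \<le> 2 * 1 * \<bar>(v - u) / 2\<bar>"
            by (intro mult_mono abs_sin_le_one abs_sin_x_le_abs_x) auto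
          finally show ?thesis by simp
        qed
        have "\<bar>cos (t \<bullet> Y n \<omega> + b) - cos (t \<bullet> Y' n \<omega> + b)\<bar> \<le> \<bar>t \<bullet> (Y n \<omega> - Y' n \<omega>)\<bar>"
          using lip[of "t \<bullet> Y n \<omega> + b" "t \<bullet> Y' n \<omega> + b"] by (simp add: inner_diff_right)
        also have "\<dots> \<le> norm t * norm (Y n \<omega> - Y' n \<omega>)" by (rule Cauchy_Schwarz_ineq2)
        finally show "norm (cos (t \<bullet> Y n \<omega> + b) - cos (t \<bullet> Y' n \<omega> + b)) \<le> norm (Y n \<omega> - Y' n \<omega>) * norm t"
          by (simp add: mult.commute)
      qed
    qed
    show "AE \<omega> in M. norm (cos (t \<bullet> Y n \<omega> + b) - cos (t \<bullet> Y' n \<omega> + b)) \<le> 2" for n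
    proof (rule AE_I2)
      fix \<omega>
      show "norm (cos (t \<bullet> Y n \<omega> + b) - cos (t \<bullet> Y' n \<omega> + b)) \<le> 2"
        using abs_cos_le_one[of "t \<bullet> Y n \<omega> + b"] abs_cos_le_one[of "t \<bullet> Y' n \<omega> + b"]
        unfolding real_norm_def by linarith
    qed
  qed auto
  then have "(\<lambda>n. (\<integral>\<omega>. cos (t \<bullet> Y n \<omega> + b) \<partial>M) - (\<integral>\<omega>. cos (t \<bullet> Y' n \<omega> + b) \<partial>M)) \<longlonglongrightarrow> 0"
    using int by simp
  from tendsto_add[OF this lim] show ?thesis by simp
qed

section \<open>Gaussian laws and their linear images\<close>

text \<open>Every normal law, the point masses included, is an affine image of the standard one; this
  spares the distinction of the degenerate case below.\<close>

lemma normal_law_affine: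
  assumes "0 \<le> \<sigma>"
  shows "normal_law m \<sigma> = distr std_normal_distribution borel (\<lambda>x. m + \<sigma> * x)"
proof -
  interpret S: prob_space std_normal_distribution by (rule prob_space_normal_density) simp
  show ?thesis
  proof (cases "\<sigma> = 0")
    case True
    have "distr std_normal_distribution borel (\<lambda>x. m) = return borel m"
      by (intro measure_eqI) (auto simp: emeasure_distr S.emeasure_space_1[simplified] indicator_def vimage_def)
    with True show ?thesis by (simp add: normal_law_def)
  next
    case False
    have "distributed std_normal_distribution lborel (\<lambda>x. x) (normal_density 0 1)"
      by (auto simp: distributed_def distr_id2)
    from S.normal_density_affine[OF this, of \<sigma> m] False
    have "distributed std_normal_distribution lborel (\<lambda>x. m + \<sigma> * x) (normal_density m \<sigma>)"
      using assms by simp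
    then have "distr std_normal_distribution lborel (\<lambda>x. m + \<sigma> * x) = density lborel (normal_density m \<sigma>)"
      by (rule distributed_distr_eq_density)
    moreover have "distr std_normal_distribution borel (\<lambda>x. m + \<sigma> * x)
        = distr std_normal_distribution lborel (\<lambda>x. m + \<sigma> * x)"
      by (rule distr_cong) simp_all
    ultimately show ?thesis using False by (simp add: normal_law_def)
  qed
qed

lemma normal_rv:
  assumes [measurable]: "U \<in> borel_measurable N" and \<sigma>: "0 \<le> \<sigma>" and law: "distr N borel U = normal_law m \<sigma>"
  shows "integrable N U" and "integrable N (\<lambda>\<omega>. (U \<omega>)\<^sup>2)" and "(\<integral>\<omega>. U \<omega> \<partial>N) = m"
    and "(\<integral>\<omega>. (U \<omega>)\<^sup>2 \<partial>N) = m\<^sup>2 + \<sigma>\<^sup>2"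
    and "(\<integral>\<omega>. cos (U \<omega> + b) \<partial>N) = exp (- \<sigma>\<^sup>2 / 2) * cos (m + b)"
proof -
  interpret S: real_distribution std_normal_distribution by (rule real_dist_normal_dist)
  have law': "distr N borel U = distr std_normal_distribution borel (\<lambda>x. m + \<sigma> * x)"
    unfolding law by (rule normal_law_affine[OF \<sigma>])
  have int: "integrable N (\<lambda>\<omega>. h (U \<omega>)) \<longleftrightarrow> integrable std_normal_distribution (\<lambda>x. h (m + \<sigma> * x))"
    and eq: "(\<integral>\<omega>. h (U \<omega>) \<partial>N) = (\<integral>x. h (m + \<sigma> * x) \<partial>std_normal_distribution)"
    if [measurable]: "h \<in> borel_measurable borel" for h :: "real \<Rightarrow> real"
  proof -
    have "integrable N (\<lambda>\<omega>. h (U \<omega>)) \<longleftrightarrow> integrable (distr N borel U) h"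
      by (subst integrable_distr_eq) auto
    also have "\<dots> \<longleftrightarrow> integrable std_normal_distribution (\<lambda>x. h (m + \<sigma> * x))"
      unfolding law' by (subst integrable_distr_eq) auto
    finally show "integrable N (\<lambda>\<omega>. h (U \<omega>)) \<longleftrightarrow> integrable std_normal_distribution (\<lambda>x. h (m + \<sigma> * x))" .
    have "(\<integral>\<omega>. h (U \<omega>) \<partial>N) = integral\<^sup>L (distr N borel U) h"
      by (subst integral_distr) auto
    also have "\<dots> = (\<integral>x. h (m + \<sigma> * x) \<partial>std_normal_distribution)"
      unfolding law' by (subst integral_distr) auto
    finally show "(\<integral>\<omega>. h (U \<omega>) \<partial>N) = (\<integral>x. h (m + \<sigma> * x) \<partial>std_normal_distribution)" .
  qed
  have i1: "integrable std_normal_distribution (\<lambda>x. x)"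
    using integrable_std_normal_distribution_moment[of 1] by simp
  have i2: "integrable std_normal_distribution (\<lambda>x. x\<^sup>2)"
    by (rule integrable_std_normal_distribution_moment)
  have m1: "(\<integral>x. x \<partial>std_normal_distribution) = 0"
    using integral_std_normal_distribution_moment_odd[of 1] by simp
  have m2: "(\<integral>x. x\<^sup>2 \<partial>std_normal_distribution) = 1"
    using std_normal_distribution_even_moments(1)[of 1] by simp
  have sq: "(m + \<sigma> * x)\<^sup>2 = m\<^sup>2 + 2 * m * \<sigma> * x + \<sigma>\<^sup>2 * x\<^sup>2" for x
    by (simp add: power2_eq_square algebra_simps)
  have j1: "integrable std_normal_distribution (\<lambda>x. m + \<sigma> * x)"
    by (intro Bochner_Integration.integrable_add S.integrable_const integrable_mult_right i1)
  have e1: "(\<integral>x. m + \<sigma> * x \<partial>std_normal_distribution) = m"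
    by (subst Bochner_Integration.integral_add[OF S.integrable_const integrable_mult_right[OF i1]])
      (simp only: integral_mult_right_zero m1 S.prob_space lebesgue_integral_const mult_zero_right real_scaleR_def)
  have j2: "integrable std_normal_distribution (\<lambda>x. m\<^sup>2 + 2 * m * \<sigma> * x)"
    by (intro Bochner_Integration.integrable_add S.integrable_const integrable_mult_right i1)
  have e2: "(\<integral>x. m\<^sup>2 + 2 * m * \<sigma> * x \<partial>std_normal_distribution) = m\<^sup>2"
    by (subst Bochner_Integration.integral_add[OF S.integrable_const integrable_mult_right[OF i1]])
      (simp only: integral_mult_right_zero m1 S.prob_space lebesgue_integral_const mult_zero_right real_scaleR_def)
  have e3: "(\<integral>x. (m + \<sigma> * x)\<^sup>2 \<partial>std_normal_distribution) = m\<^sup>2 + \<sigma>\<^sup>2"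
    unfolding sq by (subst Bochner_Integration.integral_add[OF j2 integrable_mult_right[OF i2]])
      (simp only: e2 integral_mult_right_zero m2 mult_1_right)
  have j3: "integrable std_normal_distribution (\<lambda>x. (m + \<sigma> * x)\<^sup>2)"
    unfolding sq by (intro Bochner_Integration.integrable_add j2 integrable_mult_right i2)
  show "integrable N U" by (rule int[of "\<lambda>x. x", THEN iffD2, OF _ j1]) measurable
  show "integrable N (\<lambda>\<omega>. (U \<omega>)\<^sup>2)" by (rule int[of "\<lambda>x. x\<^sup>2", THEN iffD2, OF _ j3]) measurable
  show "(\<integral>\<omega>. U \<omega> \<partial>N) = m"
    by (rule eq[of "\<lambda>x. x", THEN trans, OF _ e1]) measurable
  show "(\<integral>\<omega>. (U \<omega>)\<^sup>2 \<partial>N) = m\<^sup>2 + \<sigma>\<^sup>2"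
    by (rule eq[of "\<lambda>x. x\<^sup>2", THEN trans, OF _ e3]) measurable
  have ic: "integrable std_normal_distribution (\<lambda>x. iexp (\<sigma> * x))"
    by (rule S.integrable_iexp) auto
  have "(\<integral>x. cos (m + \<sigma> * x + b) \<partial>std_normal_distribution)
      = (\<integral>x. Re (iexp (m + b) * iexp (\<sigma> * x)) \<partial>std_normal_distribution)"
    by (intro Bochner_Integration.integral_cong) (simp_all add: exp_add[symmetric] Re_exp algebra_simps)
  also have "\<dots> = Re (CLINT x|std_normal_distribution. iexp (m + b) * iexp (\<sigma> * x))"
    using ic by (intro integral_Re) simp
  also have "(CLINT x|std_normal_distribution. iexp (m + b) * iexp (\<sigma> * x)) = iexp (m + b) * char std_normal_distribution \<sigma>"
    by (simp add: char_def)
  also have "Re \<dots> = exp (- \<sigma>\<^sup>2 / 2) * cos (m + b)"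
    by (simp add: char_std_normal_distribution Re_exp)
  finally show "(\<integral>\<omega>. cos (U \<omega> + b) \<partial>N) = exp (- \<sigma>\<^sup>2 / 2) * cos (m + b)"
    by (intro eq[of "\<lambda>x. cos (x + b)", THEN trans]) measurable
qed

lemma gaussian_rv_linear:
  fixes L :: "'b::euclidean_space \<Rightarrow> 'c::euclidean_space"
  assumes Y: "gaussian_rv N Y" and L: "linear L"
  shows "gaussian_rv N (\<lambda>\<omega>. L (Y \<omega>))"
  unfolding gaussian_rv_def
proof (intro conjI allI)
  have "L \<in> borel_measurable borel"
    using L by (intro borel_measurable_continuous_onI linear_continuous_on) (simp add: linear_conv_bounded_linear)
  then show "(\<lambda>\<omega>. L (Y \<omega>)) \<in> borel_measurable N"
    using Y by (auto simp: gaussian_rv_def intro: measurable_compose)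
  fix t
  have "t \<bullet> L y = adjoint L t \<bullet> y" for y using adjoint_works[OF L, of y t] by (simp add: inner_commute)
  then show "\<exists>m \<sigma>. \<sigma> \<ge> 0 \<and> distr N borel (\<lambda>\<omega>. t \<bullet> L (Y \<omega>)) = normal_law m \<sigma>"
    using Y by (simp add: gaussian_rv_def)
qed

lemma gaussian_rv_integrable:
  fixes Y :: "'w \<Rightarrow> 'b::euclidean_space"
  assumes Y: "gaussian_rv N Y"
  shows "integrable N Y" and "integrable N (\<lambda>\<omega>. (t \<bullet> Y \<omega>) * (u \<bullet> Y \<omega>))"
proof -
  have [measurable]: "Y \<in> borel_measurable N" using Y by (simp add: gaussian_rv_def)
  have *: "integrable N (\<lambda>\<omega>. t \<bullet> Y \<omega>)" "integrable N (\<lambda>\<omega>. (t \<bullet> Y \<omega>)\<^sup>2)" for t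
  proof -
    obtain m \<sigma> where "\<sigma> \<ge> 0" "distr N borel (\<lambda>\<omega>. t \<bullet> Y \<omega>) = normal_law m \<sigma>"
      using Y unfolding gaussian_rv_def by blast
    then show "integrable N (\<lambda>\<omega>. t \<bullet> Y \<omega>)" "integrable N (\<lambda>\<omega>. (t \<bullet> Y \<omega>)\<^sup>2)"
      by (auto intro!: normal_rv(1,2))
  qed
  have "integrable N (\<lambda>\<omega>. Y \<omega> \<bullet> b)" for b using *(1)[of b] by (simp only: inner_commute)
  then have "integrable N (\<lambda>\<omega>. \<Sum>b\<in>Basis. (Y \<omega> \<bullet> b) *\<^sub>R b)"
    by (intro Bochner_Integration.integrable_sum integrable_scaleR_left)
  then show "integrable N Y" by (simp only: euclidean_representation)
  have "integrable N (\<lambda>\<omega>. (((t + u) \<bullet> Y \<omega>)\<^sup>2 - (t \<bullet> Y \<omega>)\<^sup>2 - (u \<bullet> Y \<omega>)\<^sup>2) / 2)"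
    by (intro integrable_divide Bochner_Integration.integrable_diff *)
  then show "integrable N (\<lambda>\<omega>. (t \<bullet> Y \<omega>) * (u \<bullet> Y \<omega>))"
    by (simp add: inner_add_left power2_sum)
qed

lemma gaussian_rv_integral_cos:
  fixes Y :: "'w \<Rightarrow> 'b::euclidean_space"
  assumes Y: "gaussian_rv N Y" and mean: "integral\<^sup>L N Y = 0"
  shows "(\<integral>\<omega>. cos (t \<bullet> Y \<omega> + b) \<partial>N) = exp (- (\<integral>\<omega>. (t \<bullet> Y \<omega>)\<^sup>2 \<partial>N) / 2) * cos b"
proof -
  have [measurable]: "Y \<in> borel_measurable N" using Y by (simp add: gaussian_rv_def)
  obtain m \<sigma> where *: "\<sigma> \<ge> 0" "distr N borel (\<lambda>\<omega>. t \<bullet> Y \<omega>) = normal_law m \<sigma>"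
    using Y unfolding gaussian_rv_def by blast
  have U: "(\<lambda>\<omega>. t \<bullet> Y \<omega>) \<in> borel_measurable N" by simp
  have "(\<integral>\<omega>. t \<bullet> Y \<omega> \<partial>N) = t \<bullet> integral\<^sup>L N Y"
    using gaussian_rv_integrable(1)[OF Y] by simp
  then have "m = 0" using normal_rv(3)[OF U *] mean by simp
  then show ?thesis using normal_rv(4)[OF U *] normal_rv(5)[OF U *] by simp
qed

text \<open>The covariance matrix determines all second moments of linear functionals. Together with
  \<open>gaussian_rv_integral_cos\<close> it identifies the limit law.\<close>

lemma gaussian_rv_covar_mat:
  fixes Y :: "'w \<Rightarrow> real^'n"
  assumes Y: "gaussian_rv N Y" and mean: "integral\<^sup>L N Y = 0"
  shows "(\<integral>\<omega>. (t \<bullet> Y \<omega>) * (u \<bullet> Y \<omega>) \<partial>N) = t \<bullet> (covar_mat N Y *v u)"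
proof -
  have comp: "(\<integral>\<omega>. Y \<omega> $ i \<partial>N) = 0" for i
  proof -
    have "(\<integral>\<omega>. Y \<omega> \<bullet> axis i 1 \<partial>N) = integral\<^sup>L N Y \<bullet> axis i 1"
      using gaussian_rv_integrable(1)[OF Y] by simp
    then show ?thesis by (simp add: mean inner_axis)
  qed
  have int: "integrable N (\<lambda>\<omega>. Y \<omega> $ i * Y \<omega> $ j)" for i j
    using gaussian_rv_integrable(2)[OF Y, of "axis i 1" "axis j 1"] by (simp add: inner_axis' )
  have "(\<integral>\<omega>. (t \<bullet> Y \<omega>) * (u \<bullet> Y \<omega>) \<partial>N)
      = (\<integral>\<omega>. (\<Sum>i\<in>UNIV. \<Sum>j\<in>UNIV. (t $ i * u $ j) * (Y \<omega> $ i * Y \<omega> $ j)) \<partial>N)"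
    by (simp add: inner_vec_def sum_product ac_simps)
  also have "\<dots> = (\<Sum>i\<in>UNIV. \<Sum>j\<in>UNIV. (t $ i * u $ j) * (\<integral>\<omega>. Y \<omega> $ i * Y \<omega> $ j \<partial>N))"
    using int by (simp add: Bochner_Integration.integral_sum)
  also have "\<dots> = t \<bullet> (covar_mat N Y *v u)"
    by (simp add: covar_mat_def covar_def comp inner_vec_def matrix_vector_mult_def sum_distrib_left ac_simps)
  finally show ?thesis .
qed

lemma mv_normal_linear:
  fixes Y :: "'w \<Rightarrow> real^'n" and A :: "real^'n^'m"
  assumes "mv_normal N Y 0 S"
  shows "mv_normal N (\<lambda>\<omega>. A *v Y \<omega>) 0 (A ** S ** transpose A)"
proof -
  have Y: "gaussian_rv N Y" and mean: "integral\<^sup>L N Y = 0" and S: "covar_mat N Y = S"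
    using assms by (auto simp: mv_normal_def)
  have AY: "gaussian_rv N (\<lambda>\<omega>. A *v Y \<omega>)"
    by (rule gaussian_rv_linear[OF Y matrix_vector_mul_linear])
  have Amean: "(\<integral>\<omega>. A *v Y \<omega> \<partial>N) = 0"
  proof -
    have "(\<integral>\<omega>. A *v Y \<omega> \<partial>N) = A *v integral\<^sup>L N Y"
      by (rule integral_bounded_linear[OF _ gaussian_rv_integrable(1)[OF Y]])
        (simp add: linear_conv_bounded_linear[symmetric])
    then show ?thesis by (simp add: mean)
  qed
  have "covar_mat N (\<lambda>\<omega>. A *v Y \<omega>) $ i $ j = (A ** S ** transpose A) $ i $ j" for i j
  proof -
    have ax: "axis i 1 \<bullet> (B *v axis j 1) = B $ i $ j" for B :: "real^'m^'m" and i j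
      by (simp add: inner_axis' matrix_vector_mult_basis column_def)
    have tr: "axis i 1 \<bullet> (A *v y) = (transpose A *v axis i 1) \<bullet> y" for i y
      by (metis dot_lmul_matrix inner_commute transpose_matrix_vector)
    have "covar_mat N (\<lambda>\<omega>. A *v Y \<omega>) $ i $ j = axis i 1 \<bullet> (covar_mat N (\<lambda>\<omega>. A *v Y \<omega>) *v axis j 1)"
      by (rule ax[symmetric])
    also have "\<dots> = (\<integral>\<omega>. (axis i 1 \<bullet> (A *v Y \<omega>)) * (axis j 1 \<bullet> (A *v Y \<omega>)) \<partial>N)"
      by (rule gaussian_rv_covar_mat[OF AY Amean, symmetric])
    also have "\<dots> = (transpose A *v axis i 1) \<bullet> (S *v (transpose A *v axis j 1))"
      by (simp only: tr gaussian_rv_covar_mat[OF Y mean] S)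
    also have "\<dots> = axis i 1 \<bullet> (A *v (S *v (transpose A *v axis j 1)))" by (rule tr[symmetric])
    also have "\<dots> = axis i 1 \<bullet> ((A ** S ** transpose A) *v axis j 1)"
      by (simp only: matrix_vector_mul_assoc matrix_mul_assoc)
    also have "\<dots> = (A ** S ** transpose A) $ i $ j" by (rule ax)
    finally show ?thesis .
  qed
  then show ?thesis using AY Amean by (simp add: mv_normal_def vec_eq_iff)
qed

lemma mv_normal_W_p:
  assumes W: "W_matrix N P p W"
  shows "mv_normal N (\<lambda>\<omega>. W_p (W \<omega>)) 0 (Sigma_p P p)"
proof -
  have g: "gaussian_rv N W" and mean: "integral\<^sup>L N W = 0" using W by (auto simp: W_matrix_def)
  have lin: "linear W_p"
    by (rule linearI) (simp_all add: W_p_def vec_stack_def transpose_def vec_eq_iff)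
  have "(\<integral>\<omega>. W_p (W \<omega>) \<partial>N) = W_p (integral\<^sup>L N W)"
    using lin by (intro integral_bounded_linear gaussian_rv_integrable(1)[OF g]) (simp add: linear_conv_bounded_linear)
  also have "\<dots> = 0" by (simp add: mean linear_0[OF lin])
  finally show ?thesis
    using gaussian_rv_linear[OF g lin] Sigma_p_eq_covar_mat[OF W] by (simp add: mv_normal_def)
qed

text \<open>The Kronecker product with the row \<open>p\<close> performs the multiplication by \<open>p\<close> from the left, its
  second factor the multiplication by \<open>(I - P + A)\<^sup>-\<^sup>1\<close> from the right, which is transposed because the
  result is read as a column.\<close>

lemma vec_W_pi:
  fixes P :: "real^'s^'s" and p :: "real^'s"
  assumes "invertible (mat 1 - P + ones_mat)"
  shows "vec_stack (transpose (rowvector (W_pi P p W) :: real^'s^1)) = M_pi P p *v W_p W"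
proof -
  let ?Z = "matrix_inv (mat 1 - P + ones_mat)"
  have "transpose ones_mat = (ones_mat :: real^'s^'s)"
    by (simp add: ones_mat_def matrix_transpose_mul transpose_columnvector transpose_rowvector)
  then have "mat 1 - transpose P + ones_mat = transpose (mat 1 - P + ones_mat)"
    by (simp add: vec_eq_iff transpose_def mat_def)
  then have Zt: "matrix_inv (mat 1 - transpose P + ones_mat) = transpose ?Z"
    by (simp add: matrix_inv_transpose[OF assms])
  have "(M_pi P p *v W_p W) $ c = W_pi P p W $ snd c" for c
  proof -
    have "(M_pi P p *v W_p W) $ c = (\<Sum>(i, j)\<in>UNIV. p $ i * ?Z $ j $ snd c * W $ i $ j)"
      unfolding M_pi_def Zt
      by (simp add: matrix_vector_mult_def kron_def rowvector_def W_p_def vec_stack_def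
          transpose_def case_prod_unfold)
    also have "\<dots> = (\<Sum>i\<in>UNIV. \<Sum>j\<in>UNIV. p $ i * ?Z $ j $ snd c * W $ i $ j)"
      by (simp add: sum.cartesian_product)
    also have "\<dots> = W_pi P p W $ snd c"
      unfolding W_pi_def vector_matrix_mult_def
      by (subst sum.swap) (simp add: sum_distrib_left sum_distrib_right ac_simps)
    finally show ?thesis .
  qed
  then show ?thesis
    by (simp add: vec_eq_iff vec_stack_def transpose_def rowvector_def)
qed

section \<open>The limit law of the plug-in estimator\<close>

lemma occupation_restrict: "n \<le> Suc m \<Longrightarrow> occupation (restrict x {..m}) n = occupation x n"
  by (simp add: occupation_def vec_eq_iff)

lemma occupation_measurable:
  fixes X :: "nat \<Rightarrow> 'a \<Rightarrow> 's::finite"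
  assumes mc: "markov_chain M P X"
  shows "(\<lambda>\<omega>. occupation (\<lambda>k. X k \<omega>) n) \<in> borel_measurable M"
proof (subst borel_measurable_euclidean_space, intro ballI)
  fix b :: "real^'s"
  show "(\<lambda>\<omega>. occupation (\<lambda>k. X k \<omega>) n \<bullet> b) \<in> borel_measurable M"
    by (rule borel_measurable_integrable,
        rule integrable_path_function[OF mc, where m = n and G = "\<lambda>x. occupation x n \<bullet> b"])
      (simp add: occupation_restrict)
qed

lemma step_variance_increment:
  assumes P: "stochastic_mat P"
  shows "step_variance P (increment P u) i = (\<Sum>j\<in>UNIV. P $ i $ j * (u $ j)\<^sup>2) - ((P *v u) $ i)\<^sup>2"
proof -
  have "step_variance P (increment P u) i
     = (\<Sum>j\<in>UNIV. P $ i $ j * (u $ j)\<^sup>2 - (2 * (P *v u) $ i) * (P $ i $ j * u $ j) + ((P *v u) $ i)\<^sup>2 * P $ i $ j)"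
    unfolding step_variance_def increment_def
    by (intro sum.cong refl) (simp add: power2_eq_square algebra_simps)
  also have "\<dots> = (\<Sum>j\<in>UNIV. P $ i $ j * (u $ j)\<^sup>2) - (2 * (P *v u) $ i) * (\<Sum>j\<in>UNIV. P $ i $ j * u $ j)
      + ((P *v u) $ i)\<^sup>2 * (\<Sum>j\<in>UNIV. P $ i $ j)"
    by (simp only: sum.distrib sum_subtractf sum_distrib_left)
  also have "(\<Sum>j\<in>UNIV. P $ i $ j * u $ j) = (P *v u) $ i" by (simp add: matrix_vector_mult_def)
  finally show ?thesis using P by (simp add: stochastic_mat_def power2_eq_square)
qed

text \<open>The covariance blocks are the covariances of single transitions divided by \<open>p $ i\<close>; a row
  of \<open>W\<close> enters with the weight \<open>p $ i\<close>, whose square leaves one factor \<open>p $ i\<close>.\<close>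

lemma W_pi_second_moment:
  fixes P :: "real^'s^'s" and p :: "real^'s"
  assumes P: "stochastic_mat P" and pos: "\<And>i. 0 < p $ i" and W: "W_matrix N P p W"
    and u: "u = matrix_inv (mat 1 - P + ones_mat) *v t"
  shows "(\<integral>\<omega>. (t \<bullet> W_pi P p (W \<omega>))\<^sup>2 \<partial>N) = (\<Sum>i\<in>UNIV. step_variance P (increment P u) i * p $ i)"
proof -
  define c :: "real^('s \<times> 's)" where "c = (\<chi> r. p $ fst r * u $ snd r)"
  have c_nth: "c $ (i, j) = p $ i * u $ j" for i j by (simp add: c_def)
  have tW: "t \<bullet> W_pi P p w = c \<bullet> W_p w" for w
  proof -
    have "t \<bullet> W_pi P p w = (p v* w) \<bullet> u"
      unfolding W_pi_def u by (subst inner_commute) (simp add: dot_lmul_matrix)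
    also have "\<dots> = (\<Sum>j\<in>UNIV. \<Sum>i\<in>UNIV. p $ i * u $ j * w $ i $ j)"
      by (simp add: inner_vec_def vector_matrix_mult_def sum_distrib_left sum_distrib_right ac_simps)
    also have "\<dots> = (\<Sum>(i, j)\<in>UNIV. p $ i * u $ j * w $ i $ j)"
      by (subst sum.swap) (simp add: sum.cartesian_product)
    also have "\<dots> = c \<bullet> W_p w"
      by (simp add: inner_vec_def c_def W_p_def vec_stack_def transpose_def case_prod_unfold)
    finally show ?thesis .
  qed
  have row: "(Sigma_p P p *v c) $ (i, j) = P $ i $ j * (u $ j - (P *v u) $ i)" for i j
  proof -
    have "(Sigma_p P p *v c) $ (i, j) = (\<Sum>(k, l)\<in>UNIV. Sigma_p P p $ (i, j) $ (k, l) * c $ (k, l))"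
      by (simp add: matrix_vector_mult_def case_prod_unfold)
    also have "\<dots> = (\<Sum>k\<in>UNIV. \<Sum>l\<in>UNIV. Sigma_p P p $ (i, j) $ (k, l) * c $ (k, l))"
      by (simp add: sum.cartesian_product)
    also have "\<dots> = (\<Sum>k\<in>UNIV. if i = k then \<Sum>l\<in>UNIV. Lambda_block P i $ j $ l * u $ l else 0)"
      using pos[of i] by (intro sum.cong refl) (auto simp: Sigma_p_def c_def)
    also have "\<dots> = (\<Sum>l\<in>UNIV. Lambda_block P i $ j $ l * u $ l)" by simp
    also have "\<dots> = (\<Sum>l\<in>UNIV. (if l = j then P $ i $ j * u $ j else 0) - P $ i $ j * (P $ i $ l * u $ l))"
      by (intro sum.cong refl) (auto simp: Lambda_block_def algebra_simps)
    also have "\<dots> = P $ i $ j * u $ j - P $ i $ j * (\<Sum>l\<in>UNIV. P $ i $ l * u $ l)"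
      by (simp add: sum_subtractf sum_distrib_left)
    finally show ?thesis by (simp add: matrix_vector_mult_def right_diff_distrib)
  qed
  have "mv_normal N (\<lambda>\<omega>. W_p (W \<omega>)) 0 (Sigma_p P p)" by (rule mv_normal_W_p[OF W])
  then have g: "gaussian_rv N (\<lambda>\<omega>. W_p (W \<omega>))" "(\<integral>\<omega>. W_p (W \<omega>) \<partial>N) = 0"
    "covar_mat N (\<lambda>\<omega>. W_p (W \<omega>)) = Sigma_p P p" by (auto simp: mv_normal_def)
  have "(\<integral>\<omega>. (t \<bullet> W_pi P p (W \<omega>))\<^sup>2 \<partial>N) = c \<bullet> (Sigma_p P p *v c)"
    using gaussian_rv_covar_mat[OF g(1,2), of c c] by (simp add: tW power2_eq_square g(3))
  also have "\<dots> = (\<Sum>(i, j)\<in>UNIV. c $ (i, j) * (Sigma_p P p *v c) $ (i, j))"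
    by (simp add: inner_vec_def case_prod_unfold)
  also have "\<dots> = (\<Sum>i\<in>UNIV. \<Sum>j\<in>UNIV. c $ (i, j) * (Sigma_p P p *v c) $ (i, j))"
    by (simp add: sum.cartesian_product)
  also have "\<dots> = (\<Sum>i\<in>UNIV. step_variance P (increment P u) i * p $ i)"
  proof (intro sum.cong refl)
    fix i
    have "(\<Sum>j\<in>UNIV. c $ (i, j) * (Sigma_p P p *v c) $ (i, j))
        = (\<Sum>j\<in>UNIV. p $ i * (P $ i $ j * (u $ j)\<^sup>2) - p $ i * (P *v u) $ i * (P $ i $ j * u $ j))"
      by (intro sum.cong refl) (simp only: row c_nth, simp add: power2_eq_square algebra_simps)
    also have "\<dots> = p $ i * (\<Sum>j\<in>UNIV. P $ i $ j * (u $ j)\<^sup>2) - p $ i * (P *v u) $ i * (\<Sum>j\<in>UNIV. P $ i $ j * u $ j)"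
      by (simp only: sum_subtractf sum_distrib_left)
    also have "(\<Sum>j\<in>UNIV. P $ i $ j * u $ j) = (P *v u) $ i" by (simp add: matrix_vector_mult_def)
    finally show "(\<Sum>j\<in>UNIV. c $ (i, j) * (Sigma_p P p *v c) $ (i, j)) = step_variance P (increment P u) i * p $ i"
      by (simp add: step_variance_increment[OF P] power2_eq_square algebra_simps)
  qed
  finally show ?thesis .
qed

lemma scaled_occupation_deviation:
  fixes P :: "real^'s^'s" and p :: "real^'s"
  assumes P: "stochastic_mat P" and irr: "irreducible_mat P" and p: "stationary_dist P p"
    and n: "0 < n" and u: "u = matrix_inv (mat 1 - P + ones_mat) *v w"
  shows "w \<bullet> (sqrt (real n) *\<^sub>R (occupation x n - p))
       = path_sum (increment P u) x n / sqrt (real n) + (u $ x 0 - u $ x n) / sqrt (real n)"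
proof -
  have "sqrt (real n) * (z / real n) = z / sqrt (real n)" for z
    using n real_sqrt_mult_self[of "real n"] by (simp add: divide_simps)
  note scale = this
  have "w \<bullet> (sqrt (real n) *\<^sub>R (occupation x n - p)) = sqrt (real n) * ((occupation x n - p) \<bullet> w)"
    by (simp add: inner_commute)
  also have "\<dots> = (path_sum (increment P u) x n + u $ x 0 - u $ x n) / sqrt (real n)"
    by (simp only: occupation_deviation[OF P irr p n u] scale)
  finally show ?thesis by (simp add: add_divide_distrib diff_divide_distrib)
qed

text \<open>Each coordinate is a normalised martingale, with second moment bounded in \<open>n\<close>, plus a
  bounded term from the end points.\<close>

lemma scaled_occupation_tight:
  fixes X :: "nat \<Rightarrow> 'a \<Rightarrow> 's::finite"
  assumes P: "stochastic_mat P" and irr: "irreducible_mat P" and p: "stationary_dist P p"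
    and mc: "markov_chain M P X"
  shows "tight_seq M (\<lambda>n \<omega>. sqrt (real n) *\<^sub>R (occupation (\<lambda>k. X k \<omega>) n - p))" (is "tight_seq M ?Y")
proof -
  interpret prob_space M by (rule markov_chain_prob_space[OF mc])
  define u where "u i = matrix_inv (mat 1 - P + ones_mat) *v axis i 1" for i
  define B where "B i = (\<Sum>a\<in>UNIV. \<Sum>b\<in>UNIV. \<bar>increment P (u i) a b\<bar>)" for i
  have B: "\<bar>increment P (u i) a b\<bar> \<le> B i" for i a b unfolding B_def by (rule abs_le_double_sum_abs)
  define C where "C i = (\<Sum>j\<in>UNIV. \<bar>u i $ j\<bar>)" for i
  have C: "\<bar>u i $ j\<bar> \<le> C i" for i j unfolding C_def by (rule abs_le_sum_abs)
  have meas: "?Y n \<in> borel_measurable M" for n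
    using occupation_measurable[OF mc, of n] by measurable
  have normsq: "(norm y)\<^sup>2 = (\<Sum>i\<in>UNIV. (axis i 1 \<bullet> y)\<^sup>2)" for y :: "real^'s"
    by (simp add: power2_norm_eq_inner inner_axis') (simp add: inner_vec_def power2_eq_square)
  have int: "integrable M (\<lambda>\<omega>. (axis i 1 \<bullet> ?Y n \<omega>)\<^sup>2)" for i n
    by (rule integrable_path_function[OF mc, where m = n and
        G = "\<lambda>x. (axis i 1 \<bullet> (sqrt (real n) *\<^sub>R (occupation x n - p)))\<^sup>2"]) (simp add: occupation_restrict)
  show ?thesis
  proof (rule tight_seq_second_moment[OF prob_space_axioms meas])
    show "integrable M (\<lambda>\<omega>. (norm (?Y n \<omega>))\<^sup>2)" for n
      unfolding normsq by (intro Bochner_Integration.integrable_sum int)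
    show "eventually (\<lambda>n. (\<integral>\<omega>. (norm (?Y n \<omega>))\<^sup>2 \<partial>M) \<le> (\<Sum>i\<in>UNIV. 2 * (B i)\<^sup>2 + 2 * (2 * C i)\<^sup>2)) sequentially"
    proof (rule eventually_sequentiallyI[of 1])
      fix n :: nat assume "1 \<le> n"
      then have n: "0 < n" by simp
      have "(\<integral>\<omega>. (axis i 1 \<bullet> ?Y n \<omega>)\<^sup>2 \<partial>M) \<le> 2 * (B i)\<^sup>2 + 2 * (2 * C i)\<^sup>2" for i
      proof -
        let ?S = "\<lambda>\<omega>. path_sum (increment P (u i)) (\<lambda>k. X k \<omega>) n"
        have iS: "integrable M (\<lambda>\<omega>. (?S \<omega>)\<^sup>2)"
          by (rule integrable_path_function[OF mc, where m = n and G = "\<lambda>x. (path_sum (increment P (u i)) x n)\<^sup>2"])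
            (simp add: path_sum_restrict)
        have "(\<integral>\<omega>. (axis i 1 \<bullet> ?Y n \<omega>)\<^sup>2 \<partial>M) \<le> (\<integral>\<omega>. 2 * ((?S \<omega>)\<^sup>2 / real n) + 2 * (2 * C i)\<^sup>2 \<partial>M)"
        proof (rule integral_mono[OF int])
          show "integrable M (\<lambda>\<omega>. 2 * ((?S \<omega>)\<^sup>2 / real n) + 2 * (2 * C i)\<^sup>2)"
            by (intro Bochner_Integration.integrable_add integrable_mult_right integrable_divide iS) simp
          fix \<omega>
          let ?r = "(u i $ X 0 \<omega> - u i $ X n \<omega>) / sqrt (real n)"
          have "\<bar>?r\<bar> \<le> \<bar>u i $ X 0 \<omega> - u i $ X n \<omega>\<bar> / 1"
            unfolding abs_divide using n by (intro divide_left_mono) auto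
          also have "\<dots> \<le> 2 * C i" unfolding div_by_1 using C[of i "X 0 \<omega>"] C[of i "X n \<omega>"] by linarith
          finally have r: "?r\<^sup>2 \<le> (2 * C i)\<^sup>2" by (metis abs_ge_zero power2_abs power_mono)
          have "(axis i 1 \<bullet> ?Y n \<omega>)\<^sup>2 = (?S \<omega> / sqrt (real n) + ?r)\<^sup>2"
            by (subst scaled_occupation_deviation[OF P irr p n u_def]) (rule refl)
          also have "\<dots> \<le> 2 * (?S \<omega> / sqrt (real n))\<^sup>2 + 2 * ?r\<^sup>2"
            using zero_le_power2[of "?S \<omega> / sqrt (real n) - ?r"] unfolding power2_sum power2_diff by linarith
          also have "(?S \<omega> / sqrt (real n))\<^sup>2 = (?S \<omega>)\<^sup>2 / real n" by (simp add: power_divide)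
          finally show "(axis i 1 \<bullet> ?Y n \<omega>)\<^sup>2 \<le> 2 * ((?S \<omega>)\<^sup>2 / real n) + 2 * (2 * C i)\<^sup>2"
            using r by linarith
        qed
        also have "\<dots> = 2 * ((\<integral>\<omega>. (?S \<omega>)\<^sup>2 \<partial>M) / real n) + 2 * (2 * C i)\<^sup>2"
          by (subst Bochner_Integration.integral_add)
            (auto intro!: integrable_mult_right integrable_divide iS simp: prob_space)
        also have "(\<integral>\<omega>. (?S \<omega>)\<^sup>2 \<partial>M) / real n \<le> (B i)\<^sup>2"
          using path_sum_second_moment[where f = "increment P (u i)" and n = n, OF mc increment_mean_0[OF P] B] n
          by (simp add: field_simps)
        finally show ?thesis by simp
      qed
      then show "(\<integral>\<omega>. (norm (?Y n \<omega>))\<^sup>2 \<partial>M) \<le> (\<Sum>i\<in>UNIV. 2 * (B i)\<^sup>2 + 2 * (2 * C i)\<^sup>2)"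
        unfolding normsq
        by (subst Bochner_Integration.integral_sum[OF int]) (rule sum_mono)
    qed
  qed
qed

text \<open>In direction \<open>t\<close> the deviation is, up to the vanishing end point terms, the normalised path sum
  with variance \<open>v\<close>, and \<open>v\<close> is also the variance of \<open>t \<bullet> W_pi P p W\<close>.\<close>

lemma scaled_occupation_waves:
  fixes X :: "nat \<Rightarrow> 'a \<Rightarrow> 's::finite"
  assumes P: "stochastic_mat P" and irr: "irreducible_mat P" and p: "stationary_dist P p"
    and mc: "markov_chain M P X" and W: "W_matrix N P p W"
  shows "(\<lambda>n. \<integral>\<omega>. cos (t \<bullet> (sqrt (real n) *\<^sub>R (occupation (\<lambda>k. X k \<omega>) n - p)) + b) \<partial>M)
     \<longlonglongrightarrow> (\<integral>\<omega>. cos (t \<bullet> W_pi P p (W \<omega>) + b) \<partial>N)"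
proof -
  interpret prob_space M by (rule markov_chain_prob_space[OF mc])
  define u where "u = matrix_inv (mat 1 - P + ones_mat) *v t"
  define v where "v = (\<Sum>i\<in>UNIV. step_variance P (increment P u) i * p $ i)"
  let ?Y = "\<lambda>n \<omega>. t \<bullet> (sqrt (real n) *\<^sub>R (occupation (\<lambda>k. X k \<omega>) n - p))"
  let ?S = "\<lambda>n \<omega>. path_sum (increment P u) (\<lambda>k. X k \<omega>) n / sqrt (real n)"
  have "AE \<omega> in M. (\<lambda>n. path_sum (\<lambda>i _. step_variance P (increment P u) i) (\<lambda>k. X k \<omega>) n / real n) \<longlonglongrightarrow> v"
    using occupation_strong_law[OF P irr p mc]
  proof eventually_elim
    case (elim \<omega>)
    have "path_sum (\<lambda>i _. step_variance P (increment P u) i) (\<lambda>k. X k \<omega>) n / real n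
        = (\<Sum>i\<in>UNIV. step_variance P (increment P u) i * occupation (\<lambda>k. X k \<omega>) n $ i)" for n
      unfolding path_sum_def
      by (rule sum_path_eq_occupation[where v = "step_variance P (increment P u)" and x = "\<lambda>k. X k \<omega>"])
    then show ?case unfolding v_def by (simp only:) (intro tendsto_intros elim)
  qed
  then have clt: "(\<lambda>n. \<integral>\<omega>. cos (1 \<bullet> ?S n \<omega> + b) \<partial>M) \<longlonglongrightarrow> exp (- v / 2) * cos b"
    using path_sum_clt_cos[where f = "increment P u" and v = v and b = b, OF P mc increment_mean_0[OF P]] by simp
  have "(\<lambda>n. \<integral>\<omega>. cos (1 \<bullet> ?Y n \<omega> + b) \<partial>M) \<longlonglongrightarrow> exp (- v / 2) * cos b"
  proof (rule waves_close[OF prob_space_axioms _ _ _ clt])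
    show "?Y n \<in> borel_measurable M" for n
      using occupation_measurable[OF mc, of n] by measurable
    show "?S n \<in> borel_measurable M" for n
      by (rule borel_measurable_integrable, rule integrable_path_function[OF mc, where m = n and
          G = "\<lambda>x. path_sum (increment P u) x n / sqrt (real n)"]) (simp add: path_sum_restrict)
    show "AE \<omega> in M. (\<lambda>n. ?Y n \<omega> - ?S n \<omega>) \<longlonglongrightarrow> 0"
    proof (rule AE_I2)
      fix \<omega>
      define C where "C = (\<Sum>j\<in>UNIV. \<bar>u $ j\<bar>)"
      have C: "\<bar>u $ j\<bar> \<le> C" for j unfolding C_def by (rule abs_le_sum_abs)
      have "(\<lambda>n. 2 * C / sqrt (real n)) \<longlonglongrightarrow> 0"
        by (intro tendsto_divide_0[OF tendsto_const] filterlim_at_top_imp_at_infinity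
            filterlim_compose[OF sqrt_at_top filterlim_real_sequentially])
      then show "(\<lambda>n. ?Y n \<omega> - ?S n \<omega>) \<longlonglongrightarrow> 0"
      proof (rule Lim_null_comparison[rotated], intro eventually_sequentiallyI[of 1])
        fix n :: nat assume "1 \<le> n"
        then have "?Y n \<omega> - ?S n \<omega> = (u $ X 0 \<omega> - u $ X n \<omega>) / sqrt (real n)"
          by (subst scaled_occupation_deviation[OF P irr p _ u_def]) auto
        moreover have "\<bar>u $ X 0 \<omega> - u $ X n \<omega>\<bar> \<le> 2 * C"
          using C[of "X 0 \<omega>"] C[of "X n \<omega>"] by linarith
        ultimately show "norm (?Y n \<omega> - ?S n \<omega>) \<le> 2 * C / sqrt (real n)"
          by (simp add: abs_divide divide_right_mono)
      qed
    qed
  qed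
  moreover have "(\<integral>\<omega>. cos (t \<bullet> W_pi P p (W \<omega>) + b) \<partial>N) = exp (- v / 2) * cos b"
  proof -
    have g: "gaussian_rv N W" "integral\<^sup>L N W = 0" using W by (auto simp: W_matrix_def)
    have lin: "linear (\<lambda>w. W_pi P p w)"
      unfolding W_pi_def
      by (rule linearI) (simp_all add: vector_matrix_mult_add_rdistrib vector_matrix_left_distrib
          scaleR_vector_matrix_assoc vector_scaleR_matrix_ac)
    have "(\<integral>\<omega>. W_pi P p (W \<omega>) \<partial>N) = W_pi P p (integral\<^sup>L N W)"
      using lin by (intro integral_bounded_linear gaussian_rv_integrable(1)[OF g(1)])
        (simp add: linear_conv_bounded_linear)
    also have "\<dots> = 0" by (simp add: g linear_0[OF lin])
    finally show ?thesis
      using gaussian_rv_integral_cos[OF gaussian_rv_linear[OF g(1) lin]]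
        W_pi_second_moment[OF P stationary_dist_pos[OF P irr p] W u_def]
      by (simp add: v_def)
  qed
  ultimately show ?thesis by simp
qed

theorem proposition7:
  fixes P :: "real^'s^'s" and p :: "real^'s"
    and M :: "'a measure" and X :: "nat \<Rightarrow> 'a \<Rightarrow> 's"
    and p_hat :: "nat \<Rightarrow> 'a \<Rightarrow> real^'s"
    and N :: "'w measure" and W :: "'w \<Rightarrow> real^'s^'s"
  assumes "stochastic_mat P" and "irreducible_mat P" and "stationary_dist P p"
    and "markov_chain M P X"
    and "\<And>n. p_hat n \<in> borel_measurable M"
    and "\<And>n \<omega>. \<omega> \<in> space M \<Longrightarrow> invertible (mat 1 - P_hat X n \<omega> + ones_mat) \<Longrightarrow>
           p_hat n \<omega> = 1 v* matrix_inv (mat 1 - P_hat X n \<omega> + ones_mat)"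
    and "W_matrix N P p W"
  shows "invertible (mat 1 - P + ones_mat) \<and> p = 1 v* matrix_inv (mat 1 - P + ones_mat) \<and>
    (AE \<omega> in M. (\<lambda>n. p_hat n \<omega>) \<longlonglongrightarrow> p) \<and>
    conv_in_distr M (\<lambda>n \<omega>. sqrt (real n) *\<^sub>R (p_hat n \<omega> - p)) N (\<lambda>\<omega>. W_pi P p (W \<omega>)) \<and>
    (\<forall>\<omega>\<in>space N. vec_stack (transpose (rowvector (W_pi P p (W \<omega>)) :: real^'s^1)) =
       M_pi P p *v W_p (W \<omega>)) \<and>
    mv_normal N (\<lambda>\<omega>. vec_stack (transpose (rowvector (W_pi P p (W \<omega>)) :: real^'s^1)))
      0 (M_pi P p ** Sigma_p P p ** transpose (M_pi P p))"
proof -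
  note P = assms(1) and irr = assms(2) and p = assms(3) and mc = assms(4) and W = assms(7)
  note [measurable] = assms(5) occupation_measurable[OF mc]
  have inv: "invertible (mat 1 - P + ones_mat)" by (rule invertible_fundamental[OF P irr p])
  interpret prob_space M by (rule markov_chain_prob_space[OF mc])
  have N: "prob_space N" and g: "gaussian_rv N W" using W by (auto simp: W_matrix_def)
  let ?Y = "\<lambda>n \<omega>. sqrt (real n) *\<^sub>R (p_hat n \<omega> - p)"
  let ?Y' = "\<lambda>n \<omega>. sqrt (real n) *\<^sub>R (occupation (\<lambda>k. X k \<omega>) n - p)"
  have "AE \<omega> in M. \<exists>K. eventually (\<lambda>n. norm (p_hat n \<omega> - occupation (\<lambda>k. X k \<omega>) n) \<le> K / real n) sequentially"
    by (rule plug_in_close_to_occupation[OF P irr p mc assms(6)])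
  then have close: "AE \<omega> in M. (\<lambda>n. ?Y n \<omega> - ?Y' n \<omega>) \<longlonglongrightarrow> 0"
  proof eventually_elim
    case (elim \<omega>)
    then obtain K where K: "eventually (\<lambda>n. norm (p_hat n \<omega> - occupation (\<lambda>k. X k \<omega>) n) \<le> K / real n) sequentially"
      by blast
    have "(\<lambda>n. K / sqrt (real n)) \<longlonglongrightarrow> 0"
      by (intro tendsto_divide_0[OF tendsto_const] filterlim_at_top_imp_at_infinity
          filterlim_compose[OF sqrt_at_top filterlim_real_sequentially])
    moreover have "eventually (\<lambda>n. norm (?Y n \<omega> - ?Y' n \<omega>) \<le> K / sqrt (real n)) sequentially"
      using K eventually_gt_at_top[of 0]
    proof eventually_elim
      case (elim n)
      have "?Y n \<omega> - ?Y' n \<omega> = sqrt (real n) *\<^sub>R (p_hat n \<omega> - occupation (\<lambda>k. X k \<omega>) n)"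
        by (simp add: scaleR_diff_right)
      then have "norm (?Y n \<omega> - ?Y' n \<omega>) = sqrt (real n) * norm (p_hat n \<omega> - occupation (\<lambda>k. X k \<omega>) n)"
        by simp
      also have "\<dots> \<le> sqrt (real n) * (K / real n)" using elim by (intro mult_left_mono) auto
      also have "\<dots> = K / sqrt (real n)"
        using elim real_sqrt_mult_self[of "real n"] by (simp add: divide_simps)
      finally show ?case .
    qed
    ultimately show ?case by (rule Lim_null_comparison[rotated])
  qed
  have mY: "?Y n \<in> borel_measurable M" "?Y' n \<in> borel_measurable M" for n by measurable
  have vec: "vec_stack (transpose (rowvector (W_pi P p w) :: real^'s^1)) = M_pi P p *v W_p w" for w
    by (rule vec_W_pi[OF inv])
  have "conv_in_distr M ?Y N (\<lambda>\<omega>. W_pi P p (W \<omega>))"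
  proof (rule cramer_wold[OF prob_space_axioms N mY(1)])
    have "continuous_on UNIV (\<lambda>w. W_pi P p w)"
      unfolding W_pi_def vector_matrix_mult_def by (intro continuous_intros)
    then have "(\<lambda>w. W_pi P p w) \<in> borel_measurable borel" by (rule borel_measurable_continuous_onI)
    then show "(\<lambda>\<omega>. W_pi P p (W \<omega>)) \<in> borel_measurable N"
      using g by (auto simp: gaussian_rv_def intro: measurable_compose)
    show "(\<lambda>n. \<integral>\<omega>. cos (t \<bullet> ?Y n \<omega> + b) \<partial>M) \<longlonglongrightarrow> (\<integral>\<omega>. cos (t \<bullet> W_pi P p (W \<omega>) + b) \<partial>N)" for t b
      by (rule waves_close[OF prob_space_axioms mY close scaled_occupation_waves[OF P irr p mc W]])
    show "tight_seq M ?Y"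
      by (rule tight_seq_close[OF prob_space_axioms mY close scaled_occupation_tight[OF P irr p mc]])
  qed
  moreover have "AE \<omega> in M. (\<lambda>n. p_hat n \<omega>) \<longlonglongrightarrow> p"
    by (rule plug_in_strong_law[OF P irr p mc assms(6)])
  ultimately show ?thesis
    using inv stationary_eq_inverse[OF P irr p] mv_normal_linear[OF mv_normal_W_p[OF W], of "M_pi P p"]
    unfolding vec by blast
qed

end
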